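(* Let $F$ be a finite field with $q$ elements, and let $UT_2$ be the algebra of $2\times 2$ upper triangular matrices over $F$ with the canonical grading $UT_2^{(0)}=\mathrm{span}_F\{e_{11},e_{22}\}$, $UT_2^{(1)}=\mathrm{span}_F\{e_{12}\}$. Then the set $\{z_1z_2,\ [y_1,y_2],\ y_1^q-y_1\}$ is a basis of the superidentities of $UT_2$, i.e. $\mathrm{Id}^{gr}(UT_2)=\langle z_1z_2,\ [y_1,y_2],\ y_1^q-y_1\rangle_{T_2}$. Moreover, a linear basis of the vector space $F\langle Y\cup Z\rangle/\mathrm{Id}^{gr}(UT_2)$ is given by the images of the (distinct) polynomials of the form $$y_1^{r_1}\cdots y_m^{r_m}\,[z_j,y_{j_1}^{(s_1)},\ldots,y_{j_n}^{(s_n)}]^{\theta},$$ where $m,n,j\in\mathbb{N}$, $j_1<\cdots<j_n$, $0\le r_1,\ldots,r_m,s_1,\ldots,s_n<q$, $\theta\in\{0,1\}$ and $\sum_{i=1}^m r_i+\theta\ge 1$.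
   Context: $F\langle Y\cup Z\rangle$ is the free non-unitary associative $F$-algebra freely generated by $Y\cup Z$, $Y=\{y_1,y_2,\ldots\}$, $Z=\{z_1,z_2,\ldots\}$. It is a superalgebra ($\mathbb{Z}_2$-graded algebra) $\mathcal{F}^{(0)}\oplus\mathcal{F}^{(1)}$, where $\mathcal{F}^{(1)}$ is spanned by monomials with an odd number of occurrences of variables from $Z$ and $\mathcal{F}^{(0)}$ by the remaining monomials. A homomorphism of superalgebras is an algebra homomorphism preserving the grading. A $T_2$-ideal is a two-sided ideal invariant under all superalgebra endomorphisms of $F\langle Y\cup Z\rangle$; $\langle S\rangle_{T_2}$ is the $T_2$-ideal generated by $S$, and $S$ is called a basis of a $T_2$-ideal $I$ if $I=\langle S\rangle_{T_2}$. A polynomial $f(y_1,\ldots,y_m,z_1,\ldots,z_n)$ is a polynomial superidentity of a superalgebra $\mathcal{A}=\mathcal{A}^{(0)}\oplus\mathcal{A}^{(1)}$ if it vanishes whenever each $y_i$ is replaced by an element of $\mathcal{A}^{(0)}$ and each $z_i$ by an element of $\mathcal{A}^{(1)}$; $\mathrm{Id}^{gr}(\mathcal{A})$ is the $T_2$-ideal of all superidentities of $\mathcal{A}$. Commutators are left normed: $[u_1,u_2]=u_1u_2-u_2u_1$, $[u_1,\ldots,u_m]=[[u_1,\ldots,u_{m-1}],u_m]$ for $m>2$. Inside commutators, $[u,v^{(0)}]=u$ and $[u,v^{(r)}]=[[u,v^{(r-1)}],v]$ for $r\ge 1$ (so $[z_j,y_{j_1}^{(0)},\ldots,y_{j_n}^{(0)}]=z_j$).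 A factor with exponent $0$ in a product is omitted. $e_{ij}$ denote the elementary matrices. *)

theory Defs
  imports "HOL-Analysis.Cartesian_Space" "HOL-Library.Poly_Mapping"
begin

section \<open>Products and commutators in rings without unit\<close>

text \<open>The class \<^class>\<open>ring\<close> has no unit, so the empty product has no meaning. The value
  given to it below is a dummy; \<open>nprod\<close> is only used on nonempty lists.\<close>

fun nprod :: "'a::ring list \<Rightarrow> 'a" where
  "nprod [] = 0"
| "nprod [x] = x"
| "nprod (x # y # xs) = x * nprod (y # xs)"

definition commutator :: "'a::ring \<Rightarrow> 'a \<Rightarrow> 'a" where
  "commutator u v = u * v - v * u"

text \<open>\<open>commutator_powers u [(v\<^sub>1, r\<^sub>1), \<dots>, (v\<^sub>n, r\<^sub>n)]\<close> is the left normed commutator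
  \<open>[u, v\<^sub>1\<^sup>(\<^sup>r\<^sup>1\<^sup>), \<dots>, v\<^sub>n\<^sup>(\<^sup>r\<^sup>n\<^sup>)]\<close>.\<close>

definition commutator_powers :: "'a::ring \<Rightarrow> ('a \<times> nat) list \<Rightarrow> 'a" where
  "commutator_powers u vs = foldl (\<lambda>w (v, r). ((\<lambda>x. commutator x v) ^^ r) w) u vs"


section \<open>Superalgebras\<close>

locale superalgebra = vector_space scale
  for scale :: "'f::field \<Rightarrow> 'a::ring \<Rightarrow> 'a" +
  fixes A0 A1 :: "'a set"
  assumes scale_mult_left: "scale c x * y = scale c (x * y)"
    and scale_mult_right: "x * scale c y = scale c (x * y)"
    and subspace_A0: "subspace A0"
    and subspace_A1: "subspace A1"
    and A0_Int_A1: "A0 \<inter> A1 = {0}"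
    and A0_plus_A1: "\<exists>a\<in>A0. \<exists>b\<in>A1. x = a + b"
    and mult_00: "\<lbrakk>a \<in> A0; b \<in> A0\<rbrakk> \<Longrightarrow> a * b \<in> A0"
    and mult_01: "\<lbrakk>a \<in> A0; b \<in> A1\<rbrakk> \<Longrightarrow> a * b \<in> A1"
    and mult_10: "\<lbrakk>a \<in> A1; b \<in> A0\<rbrakk> \<Longrightarrow> a * b \<in> A1"
    and mult_11: "\<lbrakk>a \<in> A1; b \<in> A1\<rbrakk> \<Longrightarrow> a * b \<in> A0"

definition superalgebra_hom ::
  "('f::field \<Rightarrow> 'a::ring \<Rightarrow> 'a) \<Rightarrow> 'a set \<Rightarrow> 'a set \<Rightarrow>
   ('f \<Rightarrow> 'b::ring \<Rightarrow> 'b) \<Rightarrow> 'b set \<Rightarrow> 'b set \<Rightarrow> ('a \<Rightarrow> 'b) \<Rightarrow> bool" where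
  "superalgebra_hom scaleA A0 A1 scaleB B0 B1 \<phi> \<longleftrightarrow>
     Vector_Spaces.linear scaleA scaleB \<phi> \<and> (\<forall>x y. \<phi> (x * y) = \<phi> x * \<phi> y) \<and>
     \<phi> ` A0 \<subseteq> B0 \<and> \<phi> ` A1 \<subseteq> B1"


section \<open>The free superalgebra\<close>

text \<open>Indices start at 0: the variables \<open>y\<^sub>1, y\<^sub>2, \<dots>\<close> and \<open>z\<^sub>1, z\<^sub>2, \<dots>\<close> are represented
  by \<open>Y 0, Y 1, \<dots>\<close> and \<open>Z 0, Z 1, \<dots>\<close>.\<close>

datatype variable = Y nat | Z nat

datatype monomial = Monomial (letters: "variable list")

instantiation monomial :: monoid_add
begin

definition zero_monomial :: monomial where "0 = Monomial []"

definition plus_monomial :: "monomial \<Rightarrow> monomial \<Rightarrow> monomial" where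
  "a + b = Monomial (letters a @ letters b)"

instance
  by standard (simp_all add: zero_monomial_def plus_monomial_def)

end

lemma monomial_sum_eq_0_iff: "(0::monomial) = a + b \<longleftrightarrow> a = 0 \<and> b = 0"
  by (cases a; cases b) (auto simp: zero_monomial_def plus_monomial_def)

text \<open>The monomials form the free monoid, so \<^typ>\<open>monomial \<Rightarrow>\<^sub>0 'f\<close> is the free algebra with
  unit; the free algebra without unit consists of the elements with zero constant term.\<close>

typedef (overloaded) 'f free_algebra = "{p :: monomial \<Rightarrow>\<^sub>0 'f::field. Poly_Mapping.lookup p 0 = 0}"
  morphisms coeffs Abs_free_algebra
  by (rule exI[of _ 0]) simp

setup_lifting type_definition_free_algebra

instantiation free_algebra :: (field) ring
begin

lift_definition zero_free_algebra :: "'a free_algebra" is 0 by simp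
lift_definition plus_free_algebra :: "'a free_algebra \<Rightarrow> 'a free_algebra \<Rightarrow> 'a free_algebra"
  is "(+)" by (simp add: lookup_add)
lift_definition minus_free_algebra :: "'a free_algebra \<Rightarrow> 'a free_algebra \<Rightarrow> 'a free_algebra"
  is "(-)" by (simp add: lookup_minus)
lift_definition uminus_free_algebra :: "'a free_algebra \<Rightarrow> 'a free_algebra"
  is uminus by simp
lift_definition times_free_algebra :: "'a free_algebra \<Rightarrow> 'a free_algebra \<Rightarrow> 'a free_algebra"
  is "(*)"
proof -
  fix p q :: "monomial \<Rightarrow>\<^sub>0 'a"
  assume "Poly_Mapping.lookup p 0 = 0"
  moreover have "0 \<notin> Poly_Mapping.keys (p * q)" if "0 \<notin> Poly_Mapping.keys p"
    using that keys_mult[of p q] by (auto simp: monomial_sum_eq_0_iff)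
  ultimately show "Poly_Mapping.lookup (p * q) 0 = 0" by (simp add: in_keys_iff)
qed

instance
  by standard (transfer; simp add: ac_simps distrib_left distrib_right)+

end

lift_definition free_scale :: "'f::field \<Rightarrow> 'f free_algebra \<Rightarrow> 'f free_algebra"
  is "\<lambda>c. Poly_Mapping.map ((*) c)"
  by (simp add: Poly_Mapping.map.rep_eq)

lift_definition free_var :: "variable \<Rightarrow> 'f::field free_algebra"
  is "\<lambda>v. Poly_Mapping.single (Monomial [v]) 1"
  by (simp add: lookup_single zero_monomial_def)

abbreviation y_var :: "nat \<Rightarrow> 'f::field free_algebra" where "y_var i \<equiv> free_var (Y i)"

abbreviation z_var :: "nat \<Rightarrow> 'f::field free_algebra" where "z_var i \<equiv> free_var (Z i)"

global_interpretation free: vector_space "free_scale :: 'f::field \<Rightarrow> _"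
proof
  fix a b :: 'f and f g :: "'f free_algebra"
  show "free_scale a (f + g) = free_scale a f + free_scale a g"
    by transfer (simp add: mult_map_scale_conv_mult algebra_simps)
  show "free_scale (a + b) f = free_scale a f + free_scale b f"
    by transfer (simp add: mult_map_scale_conv_mult single_add algebra_simps)
  show "free_scale a (free_scale b f) = free_scale (a * b) f"
    by transfer (simp add: mult_map_scale_conv_mult mult_single flip: mult.assoc)
  show "free_scale 1 f = f"
    by transfer (simp add: mult_map_scale_conv_mult)
qed

definition z_degree :: "monomial \<Rightarrow> nat" where
  "z_degree w = length (filter (\<lambda>v. \<exists>i. v = Z i) (letters w))"

definition free_even :: "'f::field free_algebra set" where
  "free_even = free.span {nprod (map free_var (letters w)) | w. w \<noteq> 0 \<and> even (z_degree w)}"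

definition free_odd :: "'f::field free_algebra set" where
  "free_odd = free.span {nprod (map free_var (letters w)) | w. w \<noteq> 0 \<and> odd (z_degree w)}"

lemma coeffs_monomial:
  "w \<noteq> 0 \<Longrightarrow> coeffs (nprod (map free_var (letters w))) = Poly_Mapping.single w (1::'f::field)"
proof -
  have "coeffs (nprod (map free_var (v # vs))) = Poly_Mapping.single (Monomial (v # vs)) (1::'f)"
    for v vs
  proof (induction vs arbitrary: v)
    case Nil
    show ?case by (simp add: free_var.rep_eq)
  next
    case (Cons u us)
    show ?case
      using Cons.IH[of u]
      by (simp add: times_free_algebra.rep_eq free_var.rep_eq mult_single plus_monomial_def)
  qed
  then show "w \<noteq> 0 \<Longrightarrow> ?thesis"
    by (cases w rule: monomial.exhaust; cases "letters w") (auto simp: zero_monomial_def)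
qed

lemma coeffs_sum: "coeffs (sum f A) = (\<Sum>x\<in>A. coeffs (f x :: 'f::field free_algebra))"
  by (induction A rule: infinite_finite_induct)
    (auto simp: zero_free_algebra.rep_eq plus_free_algebra.rep_eq)

lemma zero_notin_keys: "0 \<notin> Poly_Mapping.keys (coeffs (f :: 'f::field free_algebra))"
  using coeffs[of f] by (simp add: in_keys_iff)

lemma lookup_coeffs_scale:
  "Poly_Mapping.lookup (coeffs (free_scale c f)) w = c * Poly_Mapping.lookup (coeffs (f :: 'f::field free_algebra)) w"
  by (simp add: free_scale.rep_eq Poly_Mapping.map.rep_eq when_def)

lemma free_algebra_expand:
  "(f :: 'f::field free_algebra) =
     (\<Sum>w\<in>Poly_Mapping.keys (coeffs f). free_scale (Poly_Mapping.lookup (coeffs f) w) (nprod (map free_var (letters w))))"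
proof -
  have "coeffs f = (\<Sum>w\<in>Poly_Mapping.keys (coeffs f). Poly_Mapping.single w (Poly_Mapping.lookup (coeffs f) w))"
    by (rule poly_mapping_eqI) (auto simp: lookup_sum lookup_single when_def in_keys_iff)
  also have "\<dots> = (\<Sum>w\<in>Poly_Mapping.keys (coeffs f).
      coeffs (free_scale (Poly_Mapping.lookup (coeffs f) w) (nprod (map free_var (letters w)))))"
  proof (rule sum.cong)
    fix w assume "w \<in> Poly_Mapping.keys (coeffs f)"
    then have "w \<noteq> 0" using zero_notin_keys by auto
    then show "Poly_Mapping.single w (Poly_Mapping.lookup (coeffs f) w) =
        coeffs (free_scale (Poly_Mapping.lookup (coeffs f) w) (nprod (map free_var (letters w))))"
      by (simp add: free_scale.rep_eq coeffs_monomial)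
  qed simp
  also have "\<dots> = coeffs (\<Sum>w\<in>Poly_Mapping.keys (coeffs f).
      free_scale (Poly_Mapping.lookup (coeffs f) w) (nprod (map free_var (letters w))))"
    by (simp only: coeffs_sum)
  finally show ?thesis by (rule coeffs_inject[THEN iffD1])
qed

lemma span_monomials:
  "free.span {nprod (map free_var (letters w)) | w. w \<noteq> 0 \<and> P w} =
     {f :: 'f::field free_algebra. \<forall>w\<in>Poly_Mapping.keys (coeffs f). P w}" (is "free.span ?S = ?T")
proof
  have "free.subspace ?T"
    unfolding free.subspace_def
    by (auto simp: zero_free_algebra.rep_eq plus_free_algebra.rep_eq in_keys_iff
        lookup_coeffs_scale lookup_add)
  moreover have "?S \<subseteq> ?T" by (auto simp: coeffs_monomial)
  ultimately show "free.span ?S \<subseteq> ?T" by (rule free.span_minimal[rotated])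
next
  show "?T \<subseteq> free.span ?S"
  proof
    fix f :: "'f free_algebra" assume "f \<in> ?T"
    then have "nprod (map free_var (letters w)) \<in> ?S" if "w \<in> Poly_Mapping.keys (coeffs f)" for w
      using that zero_notin_keys[of f] by auto
    then show "f \<in> free.span ?S"
      by (subst free_algebra_expand) (intro free.span_sum free.span_scale free.span_base)
  qed
qed

lemma free_even_iff: "f \<in> free_even \<longleftrightarrow> (\<forall>w\<in>Poly_Mapping.keys (coeffs f). even (z_degree w))"
  unfolding free_even_def span_monomials by simp

lemma free_odd_iff: "f \<in> free_odd \<longleftrightarrow> (\<forall>w\<in>Poly_Mapping.keys (coeffs f). odd (z_degree w))"
  unfolding free_odd_def span_monomials by simp

lemma z_degree_add: "z_degree (a + b) = z_degree a + z_degree b"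
  by (simp add: z_degree_def plus_monomial_def)

lemma free_keys_mult:
  assumes "w \<in> Poly_Mapping.keys (coeffs (f * g :: 'f::field free_algebra))"
  obtains a b where "w = a + b" "a \<in> Poly_Mapping.keys (coeffs f)" "b \<in> Poly_Mapping.keys (coeffs g)"
  using assms keys_mult[of "coeffs f" "coeffs g"] by (auto simp: times_free_algebra.rep_eq)

global_interpretation free:
  superalgebra "free_scale :: 'f::field \<Rightarrow> _" free_even free_odd
proof
  fix c :: 'f and f g :: "'f free_algebra"
  show "free_scale c f * g = free_scale c (f * g)"
    by transfer (simp add: mult_map_scale_conv_mult mult.assoc)
  have comm: "p * Poly_Mapping.single 0 c = Poly_Mapping.single 0 c * p"
    for p :: "monomial \<Rightarrow>\<^sub>0 'f" and c :: 'f
  proof -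
    have p: "p = (\<Sum>w\<in>Poly_Mapping.keys p. Poly_Mapping.single w (Poly_Mapping.lookup p w))"
      (is "_ = ?s")
      by (rule poly_mapping_eqI) (auto simp: lookup_sum lookup_single when_def in_keys_iff)
    have "?s * Poly_Mapping.single 0 c = Poly_Mapping.single 0 c * ?s"
      by (simp add: sum_distrib_left sum_distrib_right mult_single mult.commute)
    then show ?thesis using p by argo
  qed
  show "f * free_scale c g = free_scale c (f * g)"
    by transfer (simp add: mult_map_scale_conv_mult comm flip: mult.assoc)
  show "free.subspace (free_even :: 'f free_algebra set)" "free.subspace (free_odd :: 'f free_algebra set)"
    by (simp_all add: free_even_def free_odd_def)
  show "free_even \<inter> free_odd = {0 :: 'f free_algebra}"
  proof -
    have "f = 0" if "f \<in> free_even" "f \<in> free_odd" for f :: "'f free_algebra"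
    proof -
      have keys: "Poly_Mapping.keys (coeffs f) = {}" using that by (auto simp: free_even_iff free_odd_iff)
      have "f = (\<Sum>w\<in>Poly_Mapping.keys (coeffs f).
          free_scale (Poly_Mapping.lookup (coeffs f) w) (nprod (map free_var (letters w))))"
        by (rule free_algebra_expand)
      also have "\<dots> = 0" by (simp only: keys sum.empty)
      finally show ?thesis .
    qed
    then show ?thesis by (auto simp: free_even_iff free_odd_iff zero_free_algebra.rep_eq)
  qed
  show "\<exists>a\<in>free_even. \<exists>b\<in>free_odd. f = a + b"
  proof (intro bexI)
    let ?t = "\<lambda>w. free_scale (Poly_Mapping.lookup (coeffs f) w) (nprod (map free_var (letters w)))"
    let ?E = "{w \<in> Poly_Mapping.keys (coeffs f). even (z_degree w)}"
    let ?O = "{w \<in> Poly_Mapping.keys (coeffs f). odd (z_degree w)}"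
    have "Poly_Mapping.keys (coeffs f) = ?E \<union> ?O" by blast
    then have "f = sum ?t (?E \<union> ?O)" using free_algebra_expand[of f] by argo
    also have "\<dots> = sum ?t ?E + sum ?t ?O" by (rule sum.union_disjoint) auto
    finally show "f = sum ?t ?E + sum ?t ?O" .
    show "sum ?t ?E \<in> free_even" unfolding free_even_def
      using zero_notin_keys[of f] by (intro free.span_sum free.span_scale free.span_base) auto
    show "sum ?t ?O \<in> free_odd" unfolding free_odd_def
      using zero_notin_keys[of f] by (intro free.span_sum free.span_scale free.span_base) auto
  qed
qed (auto simp: free_even_iff free_odd_iff z_degree_add elim!: free_keys_mult)


section \<open>T2-ideals and superidentities\<close>

definition T2_ideal :: "'f::field free_algebra set \<Rightarrow> bool" where
  "T2_ideal I \<longleftrightarrow> free.subspace I \<and> (\<forall>f\<in>I. \<forall>g. f * g \<in> I \<and> g * f \<in> I) \<and>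
     (\<forall>\<phi>. superalgebra_hom (free_scale :: 'f \<Rightarrow> _) free_even free_odd
             free_scale free_even free_odd \<phi> \<longrightarrow> \<phi> ` I \<subseteq> I)"

lemma T2_ideal_hull: "T2_ideal (T2_ideal hull S)"
  by (rule hull_in) (fastforce simp: T2_ideal_def free.subspace_def)

definition substitute ::
  "('f::field \<Rightarrow> 'a::ring \<Rightarrow> 'a) \<Rightarrow> (variable \<Rightarrow> 'a) \<Rightarrow> 'f free_algebra \<Rightarrow> 'a" where
  "substitute sc \<sigma> f =
     (\<Sum>w\<in>Poly_Mapping.keys (coeffs f). sc (Poly_Mapping.lookup (coeffs f) w) (nprod (map \<sigma> (letters w))))"

definition superidentities ::
  "('f::field \<Rightarrow> 'a::ring \<Rightarrow> 'a) \<Rightarrow> 'a set \<Rightarrow> 'a set \<Rightarrow> 'f free_algebra set" where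
  "superidentities sc A0 A1 =
     {f. \<forall>\<sigma>. (\<forall>i. \<sigma> (Y i) \<in> A0) \<and> (\<forall>i. \<sigma> (Z i) \<in> A1) \<longrightarrow> substitute sc \<sigma> f = 0}"

lemma (in superalgebra) substitute_superset:
  "finite K \<Longrightarrow> Poly_Mapping.keys (coeffs f) \<subseteq> K \<Longrightarrow> substitute scale \<sigma> f =
     (\<Sum>w\<in>K. scale (Poly_Mapping.lookup (coeffs f) w) (nprod (map \<sigma> (letters w))))"
  unfolding substitute_def by (rule sum.mono_neutral_left) (auto simp: in_keys_iff)

lemma (in superalgebra) substitute_add:
  "substitute scale \<sigma> (f + g) = substitute scale \<sigma> f + substitute scale \<sigma> g"
proof -
  let ?K = "Poly_Mapping.keys (coeffs f) \<union> Poly_Mapping.keys (coeffs g)"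
  have "Poly_Mapping.keys (coeffs (f + g)) \<subseteq> ?K"
    using keys_add[of "coeffs f" "coeffs g"] by (simp add: plus_free_algebra.rep_eq)
  then show ?thesis
    by (simp add: substitute_superset[of ?K] plus_free_algebra.rep_eq lookup_add
        scale_left_distrib sum.distrib)
qed

lemma (in superalgebra) substitute_scale:
  "substitute scale \<sigma> (free_scale c f) = scale c (substitute scale \<sigma> f)"
proof -
  have "Poly_Mapping.keys (coeffs (free_scale c f)) \<subseteq> Poly_Mapping.keys (coeffs f)"
    by (auto simp: in_keys_iff lookup_coeffs_scale)
  then show ?thesis
    by (simp add: substitute_superset[of "Poly_Mapping.keys (coeffs f)"] lookup_coeffs_scale
        scale_sum_right)
qed

lemma (in superalgebra) subspace_superidentities:
  "free.subspace (superidentities scale A0 A1)"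
  unfolding free.subspace_def superidentities_def
  by (auto simp: substitute_add substitute_scale)
    (simp add: substitute_def zero_free_algebra.rep_eq)


section \<open>The superalgebra of upper triangular matrices of size 2\<close>

typedef (overloaded) 'f ut2 = "{A :: 'f::field^2^2. A $ 2 $ 1 = 0}"
  by (rule exI[of _ 0]) simp

setup_lifting type_definition_ut2

instantiation ut2 :: (field) ring
begin

lift_definition zero_ut2 :: "'a ut2" is 0 by simp
lift_definition plus_ut2 :: "'a ut2 \<Rightarrow> 'a ut2 \<Rightarrow> 'a ut2" is "(+)" by simp
lift_definition minus_ut2 :: "'a ut2 \<Rightarrow> 'a ut2 \<Rightarrow> 'a ut2" is "(-)" by simp
lift_definition uminus_ut2 :: "'a ut2 \<Rightarrow> 'a ut2" is uminus by simp
lift_definition times_ut2 :: "'a ut2 \<Rightarrow> 'a ut2 \<Rightarrow> 'a ut2" is "(**)"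
  by (simp add: matrix_matrix_mult_def sum_2)

instance
  by standard
    (transfer; simp add: matrix_mul_assoc vec_eq_iff matrix_matrix_mult_def sum_2 algebra_simps)+

end

lift_definition ut2_scale :: "'f::field \<Rightarrow> 'f ut2 \<Rightarrow> 'f ut2"
  is "\<lambda>c A. \<chi> i j. c * A $ i $ j" by simp

lift_definition e11 :: "'f::field ut2" is "\<chi> i j. if i = 1 \<and> j = 1 then 1 else 0" by simp
lift_definition e12 :: "'f::field ut2" is "\<chi> i j. if i = 1 \<and> j = 2 then 1 else 0" by simp
lift_definition e22 :: "'f::field ut2" is "\<chi> i j. if i = 2 \<and> j = 2 then 1 else 0" by simp

global_interpretation ut2: vector_space "ut2_scale :: 'f::field \<Rightarrow> _"
  by standard (transfer; simp add: vec_eq_iff algebra_simps)+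

definition ut2_even :: "'f::field ut2 set" where "ut2_even = ut2.span {e11, e22}"

definition ut2_odd :: "'f::field ut2 set" where "ut2_odd = ut2.span {e12}"

lemma ut2_even_iff: "A \<in> ut2_even \<longleftrightarrow> Rep_ut2 A $ 1 $ 2 = 0"
proof -
  have "A \<in> ut2_even \<longleftrightarrow> (\<exists>a b. A = ut2_scale a e11 + ut2_scale b e22)"
    by (auto simp: ut2_even_def ut2.span_insert algebra_simps)
  also have "\<dots> \<longleftrightarrow> Rep_ut2 A $ 1 $ 2 = 0"
    by transfer (auto simp: vec_eq_iff forall_2)
  finally show ?thesis .
qed

lemma ut2_odd_iff: "A \<in> ut2_odd \<longleftrightarrow> Rep_ut2 A $ 1 $ 1 = 0 \<and> Rep_ut2 A $ 2 $ 2 = 0"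
proof -
  have "A \<in> ut2_odd \<longleftrightarrow> (\<exists>a. A = ut2_scale a e12)"
    by (auto simp: ut2_odd_def ut2.span_singleton)
  also have "\<dots> \<longleftrightarrow> Rep_ut2 A $ 1 $ 1 = 0 \<and> Rep_ut2 A $ 2 $ 2 = 0"
    by transfer (auto simp: vec_eq_iff forall_2)
  finally show ?thesis .
qed

global_interpretation ut2: superalgebra "ut2_scale :: 'f::field \<Rightarrow> _" ut2_even ut2_odd
proof
  fix c :: 'f and A B :: "'f ut2"
  show "ut2_scale c A * B = ut2_scale c (A * B)" "A * ut2_scale c B = ut2_scale c (A * B)"
    by (transfer; simp add: vec_eq_iff matrix_matrix_mult_def sum_2 algebra_simps)+
  show "ut2.subspace (ut2_even :: 'f ut2 set)" "ut2.subspace (ut2_odd :: 'f ut2 set)"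
    by (simp_all add: ut2_even_def ut2_odd_def)
  show "ut2_even \<inter> ut2_odd = {0 :: 'f ut2}"
    by (auto simp: ut2_even_iff ut2_odd_iff zero_ut2.rep_eq)
      (transfer; simp add: vec_eq_iff forall_2)
  show "\<exists>a\<in>ut2_even. \<exists>b\<in>ut2_odd. A = a + b"
  proof (intro bexI)
    let ?E = "ut2_scale (Rep_ut2 A $ 1 $ 1) e11 + ut2_scale (Rep_ut2 A $ 2 $ 2) e22"
    let ?O = "ut2_scale (Rep_ut2 A $ 1 $ 2) e12"
    show "A = ?E + ?O" by transfer (simp add: vec_eq_iff forall_2)
    show "?E \<in> ut2_even" "?O \<in> ut2_odd"
      by (simp_all add: ut2_even_def ut2_odd_def ut2.span_add ut2.span_scale ut2.span_base)
  qed
next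
  fix A B :: "'f ut2"
  have ut: "Rep_ut2 A $ 2 $ 1 = 0" "Rep_ut2 B $ 2 $ 1 = 0"
    using Rep_ut2 by auto
  note simps = ut ut2_even_iff ut2_odd_iff times_ut2.rep_eq matrix_matrix_mult_def sum_2
  show "A * B \<in> ut2_even" if "A \<in> ut2_even" "B \<in> ut2_even" using that by (simp add: simps)
  show "A * B \<in> ut2_odd" if "A \<in> ut2_even" "B \<in> ut2_odd" using that by (simp add: simps)
  show "A * B \<in> ut2_odd" if "A \<in> ut2_odd" "B \<in> ut2_even" using that by (simp add: simps)
  show "A * B \<in> ut2_even" if "A \<in> ut2_odd" "B \<in> ut2_odd" using that by (simp add: simps)
qed

abbreviation Id_gr_ut2 :: "'f::field free_algebra set" where
  "Id_gr_ut2 \<equiv> superidentities ut2_scale ut2_even ut2_odd"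


section \<open>The quotient of the free algebra by the superidentities\<close>

quotient_type (overloaded) 'f rel_free = "'f::field free_algebra" /
    "\<lambda>f g. f - g \<in> (Id_gr_ut2 :: 'f free_algebra set)"
  morphisms rep_rel_free rel_free_class
proof (rule equivpI)
  note S = ut2.subspace_superidentities
  show "reflp (\<lambda>f g. f - g \<in> (Id_gr_ut2 :: 'f free_algebra set))"
    by (rule reflpI) (simp add: free.subspace_0[OF S])
  show "symp (\<lambda>f g. f - g \<in> (Id_gr_ut2 :: 'f free_algebra set))"
    by (rule sympI) (metis free.subspace_neg[OF S] minus_diff_eq)
  show "transp (\<lambda>f g. f - g \<in> (Id_gr_ut2 :: 'f free_algebra set))"
  proof (rule transpI)
    fix f g h :: "'f free_algebra"
    assume "f - g \<in> Id_gr_ut2" "g - h \<in> Id_gr_ut2"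
    from free.subspace_add[OF S this] show "f - h \<in> Id_gr_ut2" by simp
  qed
qed

instantiation rel_free :: (field) ab_group_add
begin

lift_definition zero_rel_free :: "'a rel_free" is 0 .
lift_definition plus_rel_free :: "'a rel_free \<Rightarrow> 'a rel_free \<Rightarrow> 'a rel_free" is "(+)"
  by (metis add_diff_add free.subspace_add[OF ut2.subspace_superidentities])
lift_definition minus_rel_free :: "'a rel_free \<Rightarrow> 'a rel_free \<Rightarrow> 'a rel_free" is "(-)"
proof -
  fix f f' g g' :: "'a free_algebra"
  assume "f - f' \<in> Id_gr_ut2" "g - g' \<in> Id_gr_ut2"
  from free.subspace_diff[OF ut2.subspace_superidentities this]
  show "f - g - (f' - g') \<in> Id_gr_ut2" by (simp add: algebra_simps)
qed
lift_definition uminus_rel_free :: "'a rel_free \<Rightarrow> 'a rel_free" is uminus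
proof -
  fix f g :: "'a free_algebra"
  assume "f - g \<in> Id_gr_ut2"
  from free.subspace_neg[OF ut2.subspace_superidentities this]
  show "- f - - g \<in> Id_gr_ut2" by simp
qed

instance
  by standard (transfer; simp add: algebra_simps free.subspace_0[OF ut2.subspace_superidentities])+

end

lift_definition rel_free_scale :: "'f::field \<Rightarrow> 'f rel_free \<Rightarrow> 'f rel_free" is free_scale
  by (metis free.scale_right_diff_distrib free.subspace_scale[OF ut2.subspace_superidentities])

global_interpretation rel_free: vector_space "rel_free_scale :: 'f::field \<Rightarrow> _"
  by standard
    (transfer; simp add: free.scale_left_distrib free.scale_right_distrib
      free.subspace_0[OF ut2.subspace_superidentities])+


section \<open>The polynomials of the linear basis\<close>

text \<open>The polynomial
  \<open>y\<^sub>1\<^sup>r\<^sup>1 \<dots> y\<^sub>m\<^sup>r\<^sup>m [z\<^sub>j, y\<^sub>j\<^sub>1\<^sup>(\<^sup>s\<^sup>1\<^sup>), \<dots>, y\<^sub>j\<^sub>n\<^sup>(\<^sup>s\<^sup>n\<^sup>)]\<^sup>\<theta>\<close> with shifted indices: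
  the exponents are \<open>r 0, \<dots>, r (m - 1)\<close> and \<open>s 0, \<dots>, s (n - 1)\<close>, the
  indices in the commutator are \<open>js 0, \<dots>, js (n - 1)\<close>.\<close>

definition basis_poly ::
  "nat \<Rightarrow> (nat \<Rightarrow> nat) \<Rightarrow> nat \<Rightarrow> nat \<Rightarrow> (nat \<Rightarrow> nat) \<Rightarrow> (nat \<Rightarrow> nat) \<Rightarrow> nat \<Rightarrow> 'f::field free_algebra"
  where
  "basis_poly m r j n js s \<theta> =
     nprod (concat (map (\<lambda>i. replicate (r i) (y_var i)) [0..<m]) @
            replicate \<theta> (commutator_powers (z_var j) (map (\<lambda>i. (y_var (js i), s i)) [0..<n])))"

definition basis_polys :: "nat \<Rightarrow> 'f::field free_algebra set" where
  "basis_polys q = {basis_poly m r j n js s \<theta> | m r j n js s \<theta>.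
     strict_mono_on {..<n} js \<and> (\<forall>i<m. r i < q) \<and> (\<forall>i<n. s i < q) \<and>
     \<theta> \<in> {0, 1} \<and> (\<Sum>i<m. r i) + \<theta> \<ge> 1}"

end

theory Submission
  imports "HOL-Computational_Algebra.Polynomial" Defs
begin

text \<open>Modulo the three relations a word with two letters \<open>z\<close> vanishes, the letters \<open>y\<close> commute
  and satisfy \<open>y\<^sup>q = y\<close>, and in a word \<open>u z v\<close> the letters of \<open>v\<close> are moved to the left
  of \<open>z\<close> by \<open>w y = y w + [w, y]\<close>; so the listed polynomials span the quotient. Evaluating
  \<open>y\<^sub>i\<close> at \<open>a\<^sub>i e\<^sub>1\<^sub>1 + (a\<^sub>i + d\<^sub>i) e\<^sub>2\<^sub>2\<close> and \<open>z\<^sub>j\<close> at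
  \<open>c\<^sub>j e\<^sub>1\<^sub>2\<close> turns them into monomials in the \<open>a\<^sub>i\<close>, \<open>d\<^sub>i\<close>, \<open>c\<^sub>j\<close> with exponents
  below \<open>q\<close> in the \<open>a\<^sub>i\<close> and \<open>d\<^sub>i\<close>, which are linearly independent as functions over a
  field with \<open>q\<close> elements. Hence a superidentity reduces to the zero combination, that is, it
  follows from the three relations.\<close>

section \<open>Products in rings without unit\<close>

lemma nprod_Cons: "xs \<noteq> [] \<Longrightarrow> nprod (x # xs) = x * nprod xs"
  by (cases xs) auto

lemma nprod_append: "xs \<noteq> [] \<Longrightarrow> ys \<noteq> [] \<Longrightarrow> nprod (xs @ ys) = nprod xs * nprod ys"
  by (induction xs rule: nprod.induct) (auto simp: nprod_Cons mult.assoc)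

text \<open>Lets ring identities act on a block inside a product. Empty contexts are separate cases
  because the empty product is a dummy and not a unit.\<close>

lemma nprod_collapse: "xs \<noteq> [] \<Longrightarrow> nprod (A @ xs @ B) = nprod (A @ nprod xs # B)"
  by (cases "A = []"; cases "B = []") (auto simp: nprod_append nprod_Cons)

lemma nprod_insert_add: "nprod (A @ (x + y) # B) = nprod (A @ x # B) + nprod (A @ y # B)"
  by (cases "A = []"; cases "B = []") (auto simp: nprod_append nprod_Cons algebra_simps)

lemma nprod_insert_diff: "nprod (A @ (x - y) # B) = nprod (A @ x # B) - nprod (A @ y # B)"
  by (cases "A = []"; cases "B = []") (auto simp: nprod_append nprod_Cons algebra_simps)

lemma nprod_map_hom:
  assumes "\<And>x y. \<phi> (x * y) = \<phi> x * \<phi> y" "xs \<noteq> []"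
  shows "\<phi> (nprod xs) = nprod (map \<phi> xs)"
  using assms(2) by (induction xs rule: nprod.induct) (auto simp: assms(1))

text \<open>The rewriting \<open>w * v = v * w + [w, v]\<close> inside a product; it later carries
  letters \<open>y\<close> from the right of a commutator to its left.\<close>

lemma nprod_move_right:
  "nprod (A @ w # v # B) = nprod (A @ v # w # B) + nprod (A @ commutator w v # B)"
proof -
  have "w * v = v * w + commutator w v" by (simp add: commutator_def)
  then have "nprod (A @ (w * v) # B) = nprod (A @ (v * w) # B) + nprod (A @ commutator w v # B)"
    by (simp only: nprod_insert_add)
  then show ?thesis using nprod_collapse[of "[w, v]" A B] nprod_collapse[of "[v, w]" A B] by simp
qed


section \<open>Substitution homomorphisms and superidentities\<close>

text \<open>Nonempty words span the algebra, and every element has finite support, so induction over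
  subsets of the support suffices.\<close>

lemma free_algebra_induct [case_names zero add monomial]:
  fixes f :: "'f::field free_algebra"
  assumes "P 0" "\<And>f g. P f \<Longrightarrow> P g \<Longrightarrow> P (f + g)"
    and "\<And>c l. l \<noteq> [] \<Longrightarrow> P (free_scale c (nprod (map free_var l)))"
  shows "P f"
proof -
  let ?t = "\<lambda>w. free_scale (Poly_Mapping.lookup (coeffs f) w) (nprod (map free_var (letters w)))"
  have "P (sum ?t K)" if "finite K" "K \<subseteq> Poly_Mapping.keys (coeffs f)" for K
    using that
  proof (induction K rule: finite_induct)
    case empty
    then show ?case using assms(1) by simp
  next
    case (insert w K)
    have "w \<noteq> 0" using insert.prems zero_notin_keys[of f] by blast
    then have "letters w \<noteq> []" by (cases w) (simp add: zero_monomial_def)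
    then have "P (?t w)" by (rule assms(3))
    moreover have "P (sum ?t K)" using insert.prems by (intro insert.IH) simp
    ultimately have "P (?t w + sum ?t K)" by (rule assms(2))
    also have "?t w + sum ?t K = sum ?t (insert w K)" by (rule sum.insert[symmetric, OF insert.hyps])
    finally show ?case .
  qed
  from this[OF finite_keys subset_refl] have "P (sum ?t (Poly_Mapping.keys (coeffs f)))" .
  moreover have "sum ?t (Poly_Mapping.keys (coeffs f)) = f" by (rule free_algebra_expand[symmetric])
  ultimately show ?thesis by (rule back_subst[of P])
qed

lemma free_var_graded:
  "y_var i \<in> (free_even :: 'f::field free_algebra set)"
  "z_var i \<in> (free_odd :: 'f::field free_algebra set)"
  by (auto simp: free_even_iff free_odd_iff free_var.rep_eq z_degree_def)

context superalgebra
begin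

lemma substitute_zero [simp]: "substitute scale \<sigma> 0 = 0"
  by (simp add: substitute_def zero_free_algebra.rep_eq)

lemma substitute_diff: "substitute scale \<sigma> (f - g) = substitute scale \<sigma> f - substitute scale \<sigma> g"
  using substitute_add[of \<sigma> "f - g" g] by (metis add_diff_cancel_right' diff_add_cancel)

lemma substitute_sum: "substitute scale \<sigma> (sum f A) = (\<Sum>x\<in>A. substitute scale \<sigma> (f x))"
  by (induction A rule: infinite_finite_induct) (auto simp: substitute_add)

lemma substitute_word:
  "l \<noteq> [] \<Longrightarrow> substitute scale \<sigma> (nprod (map free_var l)) = nprod (map \<sigma> l)"
  using coeffs_monomial[of "Monomial l", where ?'f = 'f]
  unfolding substitute_def by (simp add: zero_monomial_def)

lemma substitute_var [simp]: "substitute scale \<sigma> (free_var v) = \<sigma> v"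
  using substitute_word[of "[v]"] by simp

text \<open>Both sides are bilinear, so two nested inductions reduce the claim to words, where it is
  concatenation of products.\<close>

lemma substitute_mult: "substitute scale \<sigma> (f * g) = substitute scale \<sigma> f * substitute scale \<sigma> g"
proof (induction f rule: free_algebra_induct)
  case (monomial c l)
  show ?case
  proof (induction g rule: free_algebra_induct)
    case (monomial d l')
    have "free_scale c (nprod (map free_var l)) * free_scale d (nprod (map free_var l')) =
        free_scale c (free_scale d (nprod (map free_var (l @ l'))))"
      using \<open>l \<noteq> []\<close> \<open>l' \<noteq> []\<close>
      by (simp only: free.scale_mult_left free.scale_mult_right nprod_append map_append)
         (simp add: nprod_append free.scale_mult_right)
    then show ?case using \<open>l \<noteq> []\<close> \<open>l' \<noteq> []\<close>
      by (simp add: substitute_scale substitute_word nprod_append scale_mult_left scale_mult_right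
          flip: map_append)
         (simp add: nprod_append)
  qed (auto simp: substitute_add algebra_simps)
qed (auto simp: substitute_add algebra_simps)

lemma nprod_graded:
  assumes "\<And>i. \<sigma> (Y i) \<in> A0" "\<And>i. \<sigma> (Z i) \<in> A1" "l \<noteq> []"
  shows "(even (z_degree (Monomial l)) \<longrightarrow> nprod (map \<sigma> l) \<in> A0) \<and>
         (odd (z_degree (Monomial l)) \<longrightarrow> nprod (map \<sigma> l) \<in> A1)"
  using assms(3)
proof (induction l)
  case (Cons v l)
  show ?case
  proof (cases "l = []")
    case True
    then show ?thesis using assms(1,2) by (cases v) (auto simp: z_degree_def)
  next
    case False
    with Cons show ?thesis using assms(1,2)
      by (cases v) (auto simp: z_degree_def nprod_Cons intro: mult_00 mult_01 mult_10 mult_11)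
  qed
qed simp

lemma substitute_graded:
  assumes "\<And>i. \<sigma> (Y i) \<in> A0" "\<And>i. \<sigma> (Z i) \<in> A1"
  shows "f \<in> free_even \<Longrightarrow> substitute scale \<sigma> f \<in> A0"
    and "f \<in> free_odd \<Longrightarrow> substitute scale \<sigma> f \<in> A1"
proof -
  have *: "letters w \<noteq> []" "Monomial (letters w) = w" if "w \<in> Poly_Mapping.keys (coeffs f)" for w
    using that zero_notin_keys[of f] by (cases w; auto simp: zero_monomial_def)+
  show "substitute scale \<sigma> f \<in> A0" if f: "f \<in> free_even"
    unfolding substitute_def
  proof (intro subspace_sum subspace_scale subspace_A0)
    fix w assume w: "w \<in> Poly_Mapping.keys (coeffs f)"
    then have "even (z_degree (Monomial (letters w)))" using f * by (simp add: free_even_iff)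
    then show "nprod (map \<sigma> (letters w)) \<in> A0" using nprod_graded[OF assms *(1)[OF w]] by blast
  qed
  show "substitute scale \<sigma> f \<in> A1" if f: "f \<in> free_odd"
    unfolding substitute_def
  proof (intro subspace_sum subspace_scale subspace_A1)
    fix w assume w: "w \<in> Poly_Mapping.keys (coeffs f)"
    then have "odd (z_degree (Monomial (letters w)))" using f * by (simp add: free_odd_iff)
    then show "nprod (map \<sigma> (letters w)) \<in> A1" using nprod_graded[OF assms *(1)[OF w]] by blast
  qed
qed

lemma superalgebra_hom_substitute:
  assumes "\<And>i. \<sigma> (Y i) \<in> A0" "\<And>i. \<sigma> (Z i) \<in> A1"
  shows "superalgebra_hom free_scale free_even free_odd scale A0 A1 (substitute scale \<sigma>)"
proof -
  have "Vector_Spaces.linear free_scale scale (substitute scale \<sigma>)"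
    by unfold_locales (auto simp: substitute_add substitute_scale)
  then show ?thesis
    using substitute_graded[OF assms] by (auto simp: superalgebra_hom_def substitute_mult)
qed

text \<open>Both sides are algebra homomorphisms in \<open>f\<close>, so agreement on the variables
  is enough.\<close>

lemma substitute_compose:
  assumes "superalgebra_hom free_scale free_even free_odd free_scale free_even free_odd \<phi>"
  shows "substitute scale \<sigma> (\<phi> f) = substitute scale (\<lambda>v. substitute scale \<sigma> (\<phi> (free_var v))) f"
proof -
  interpret \<phi>: Vector_Spaces.linear free_scale free_scale \<phi>
    using assms by (simp add: superalgebra_hom_def)
  have mult: "\<phi> (x * y) = \<phi> x * \<phi> y" for x y using assms by (simp add: superalgebra_hom_def)
  show ?thesis
  proof (induction f rule: free_algebra_induct)
    case (monomial c l)
    then show ?case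
      by (simp add: \<phi>.scale substitute_scale substitute_word nprod_map_hom[of \<phi>, OF mult] o_def
          nprod_map_hom[of "substitute scale \<sigma>", OF substitute_mult])
  qed (auto simp: \<phi>.add substitute_add \<phi>.zero)
qed

text \<open>A superendomorphism followed by an admissible substitution is again an admissible
  substitution, because the images of the variables keep their parity.\<close>

lemma T2_ideal_superidentities: "T2_ideal (superidentities scale A0 A1)"
  unfolding T2_ideal_def
proof (intro conjI allI impI ballI subsetI)
  fix \<phi> g
  assume \<phi>: "superalgebra_hom free_scale free_even free_odd free_scale free_even free_odd \<phi>"
    and "g \<in> \<phi> ` superidentities scale A0 A1"
  then obtain f where f: "f \<in> superidentities scale A0 A1" "g = \<phi> f" by auto
  show "g \<in> superidentities scale A0 A1"
    unfolding superidentities_def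
  proof (intro CollectI allI impI)
    fix \<sigma> assume \<sigma>: "(\<forall>i. \<sigma> (Y i) \<in> A0) \<and> (\<forall>i. \<sigma> (Z i) \<in> A1)"
    have "\<phi> (y_var i) \<in> free_even" "\<phi> (z_var i) \<in> free_odd" for i
      using \<phi> free_var_graded[of i, where ?'f = 'f] by (auto simp: superalgebra_hom_def image_subset_iff)
    then have "substitute scale \<sigma> (\<phi> (y_var i)) \<in> A0" "substitute scale \<sigma> (\<phi> (z_var i)) \<in> A1" for i
      using \<sigma> substitute_graded[of \<sigma>] by blast+
    then show "substitute scale \<sigma> g = 0"
      using f unfolding f(2) by (subst substitute_compose[OF \<phi>]) (simp add: superidentities_def)
  qed
qed (rule subspace_superidentities, auto simp: superidentities_def substitute_mult)

end


section \<open>Reduction modulo the relations\<close>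

abbreviation y_block :: "(nat \<Rightarrow> nat) \<Rightarrow> nat list \<Rightarrow> 'f::field free_algebra list" where
  "y_block r is \<equiv> concat (map (\<lambda>i. replicate (r i) (y_var i)) is)"

lemma y_block_cong: "(\<And>i. i \<in> set is \<Longrightarrow> r i = s i) \<Longrightarrow> y_block r is = y_block s is"
  by (induction "is") auto

text \<open>Exponent 0 stands for an absent variable, so consecutive indices suffice and the
  increasing index map of \<open>basis_poly\<close> can be the identity.\<close>

definition z_commutator :: "nat \<Rightarrow> (nat \<Rightarrow> nat) \<Rightarrow> nat \<Rightarrow> 'f::field free_algebra" where
  "z_commutator n s j = commutator_powers (z_var j) (map (\<lambda>i. (y_var i, s i)) [0..<n])"

lemma z_commutator_0 [simp]: "z_commutator 0 s j = z_var j"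
  by (simp add: z_commutator_def commutator_powers_def)

lemma z_commutator_Suc:
  "z_commutator (Suc n) s j = ((\<lambda>x. commutator x (y_var n)) ^^ s n) (z_commutator n s j)"
  by (simp add: z_commutator_def commutator_powers_def)

lemma z_commutator_upd [simp]: "z_commutator n (s(n := i)) j = z_commutator n s j"
  unfolding z_commutator_def by (rule arg_cong[where f = "commutator_powers _"]) simp

lemma word_split_Z: "(\<exists>us. l = map Y us) \<or> (\<exists>us j l'. l = map Y us @ Z j # l')"
proof (induction l)
  case (Cons v l)
  show ?case
  proof (cases v)
    case (Y a)
    from Cons.IH show ?thesis
    proof (elim disjE exE)
      fix us assume "l = map Y us"
      then have "v # l = map Y (a # us)" using Y by simp
      then show ?thesis by (intro disjI1 exI)
    next
      fix us j l' assume "l = map Y us @ Z j # l'"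
      then have "v # l = map Y (a # us) @ Z j # l'" using Y by simp
      then show ?thesis by (intro disjI2 exI)
    qed
  next
    case (Z j)
    then have "v # l = map Y [] @ Z j # l" by simp
    then show ?thesis by (intro disjI2 exI)
  qed
qed simp

text \<open>Interpreted twice: for the superidentities, to span the quotient, and for the T2-ideal
  generated by the relations, to reduce modulo that ideal.\<close>

locale ut2_relations =
  fixes I :: "'f::{field,finite} free_algebra set"
  assumes T2: "T2_ideal I"
    and zz: "z_var 0 * z_var 1 \<in> I"
    and yy: "commutator (y_var 0) (y_var 1) \<in> I"
    and yq: "nprod (replicate CARD('f) (y_var 0)) - y_var 0 \<in> I"
begin

lemma CARD_gt_1: "1 < CARD('f)"
proof -
  have "card {0, 1 :: 'f} \<le> CARD('f)" by (rule card_mono) auto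
  then show ?thesis by simp
qed

lemma I_subspace: "free.subspace I"
  using T2 by (simp add: T2_ideal_def)

lemma I_nprod:
  assumes "x \<in> I" shows "nprod (A @ x # B) \<in> I"
proof -
  have "f * x \<in> I" "x * f \<in> I" "f * (x * g) \<in> I" for f g
    using T2 assms unfolding T2_ideal_def by blast+
  then show ?thesis using assms by (cases "A = []"; cases "B = []") (auto simp: nprod_append nprod_Cons)
qed

lemma I_substitute:
  assumes "f \<in> I" "\<And>i. \<sigma> (Y i) \<in> free_even" "\<And>i. \<sigma> (Z i) \<in> free_odd"
  shows "substitute free_scale \<sigma> f \<in> I"
proof -
  have "superalgebra_hom free_scale free_even free_odd free_scale free_even free_odd
      (substitute free_scale \<sigma>)"
    using assms(2,3) by (rule free.superalgebra_hom_substitute)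
  then have "substitute free_scale \<sigma> ` I \<subseteq> I" using T2 unfolding T2_ideal_def by blast
  then show ?thesis using assms(1) by blast
qed

text \<open>Invariance under superendomorphisms carries the relation from variables to arbitrary odd
  elements. The even variables go to 0, which lies in the even part.\<close>

lemma odd_mult:
  assumes "a \<in> free_odd" "b \<in> free_odd" shows "a * b \<in> I"
proof -
  define \<sigma> where "\<sigma> v = (case v of Y i \<Rightarrow> 0 | Z i \<Rightarrow> if i = 0 then a else b)" for v
  have "substitute free_scale \<sigma> (z_var 0 * z_var 1) \<in> I"
    using zz by (rule I_substitute)
      (auto simp: \<sigma>_def assms free.subspace_0[OF free.subspace_A0])
  then show ?thesis by (simp add: free.substitute_mult \<sigma>_def)
qed

lemma even_commutator:
  assumes "a \<in> free_even" "b \<in> free_even" shows "commutator a b \<in> I"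
proof -
  define \<sigma> where "\<sigma> v = (case v of Z i \<Rightarrow> 0 | Y i \<Rightarrow> if i = 0 then a else b)" for v
  have "substitute free_scale \<sigma> (commutator (y_var 0) (y_var 1)) \<in> I"
    using yy by (rule I_substitute)
      (auto simp: \<sigma>_def assms free.subspace_0[OF free.subspace_A1])
  then show ?thesis
    by (simp add: free.substitute_mult free.substitute_diff commutator_def \<sigma>_def)
qed

lemma even_power:
  assumes "a \<in> free_even" shows "nprod (replicate CARD('f) a) - a \<in> I"
proof -
  define \<sigma> where "\<sigma> v = (case v of Z i \<Rightarrow> 0 | Y i \<Rightarrow> a)" for v
  have "substitute free_scale \<sigma> (nprod (replicate CARD('f) (y_var 0)) - y_var 0) \<in> I"
    using yq by (rule I_substitute)
      (auto simp: \<sigma>_def assms free.subspace_0[OF free.subspace_A1])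
  moreover have "substitute free_scale \<sigma> (nprod (replicate CARD('f) (y_var 0))) = nprod (replicate CARD('f) a)"
    using free.substitute_word[of "replicate CARD('f) (Y 0)" \<sigma>] by (simp add: \<sigma>_def)
  ultimately show ?thesis by (simp add: free.substitute_diff \<sigma>_def)
qed

text \<open>Lists of factors are related instead of products because the empty product
  has no meaning in a ring without unit.\<close>

definition eqv :: "'f free_algebra list \<Rightarrow> 'f free_algebra list \<Rightarrow> bool" where
  "eqv xs ys \<longleftrightarrow> (\<forall>A B. nprod (A @ xs @ B) - nprod (A @ ys @ B) \<in> I)"

lemma eqv_refl [simp]: "eqv xs xs"
  by (simp add: eqv_def free.subspace_0[OF I_subspace])

lemma eqv_trans [trans]: "eqv xs ys \<Longrightarrow> eqv ys zs \<Longrightarrow> eqv xs zs"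
  unfolding eqv_def
proof (intro allI)
  fix A B
  assume "\<forall>A B. nprod (A @ xs @ B) - nprod (A @ ys @ B) \<in> I"
    "\<forall>A B. nprod (A @ ys @ B) - nprod (A @ zs @ B) \<in> I"
  then have "nprod (A @ xs @ B) - nprod (A @ ys @ B) + (nprod (A @ ys @ B) - nprod (A @ zs @ B)) \<in> I"
    by (intro free.subspace_add[OF I_subspace]) blast+
  then show "nprod (A @ xs @ B) - nprod (A @ zs @ B) \<in> I" by simp
qed

lemma eqv_context: "eqv xs ys \<Longrightarrow> eqv (C @ xs @ D) (C @ ys @ D)"
  unfolding eqv_def by (metis append.assoc)

lemma eqv_Cons: "eqv xs ys \<Longrightarrow> eqv (x # xs) (x # ys)"
  using eqv_context[of xs ys "[x]" "[]"] by simp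

lemma eqv_swap:
  assumes "a \<in> free_even" "b \<in> free_even" shows "eqv [a, b] [b, a]"
  unfolding eqv_def
proof (intro allI)
  fix A B
  show "nprod (A @ [a, b] @ B) - nprod (A @ [b, a] @ B) \<in> I"
    using I_nprod[OF even_commutator[OF assms], of A B] nprod_move_right[of A a b B] by simp
qed

lemma eqv_power:
  assumes "a \<in> free_even" shows "eqv (replicate CARD('f) a) [a]"
  unfolding eqv_def
proof (intro allI)
  fix A B
  have "nprod (A @ replicate CARD('f) a @ B) = nprod (A @ nprod (replicate CARD('f) a) # B)"
    by (rule nprod_collapse) simp
  then show "nprod (A @ replicate CARD('f) a @ B) - nprod (A @ [a] @ B) \<in> I"
    using I_nprod[OF even_power[OF assms], of A B] by (simp add: nprod_insert_diff)
qed

lemma eqv_move: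
  assumes "a \<in> free_even" "set xs \<subseteq> free_even" shows "eqv (a # xs) (xs @ [a])"
  using assms(2)
proof (induction xs)
  case (Cons x xs)
  have "eqv (a # x # xs) (x # a # xs)"
    using eqv_context[OF eqv_swap[OF assms(1), of x], of "[]" xs] Cons.prems by simp
  also have "eqv \<dots> (x # xs @ [a])" using Cons by (intro eqv_Cons) auto
  finally show ?case by simp
qed simp

text \<open>Letters are inserted one at a time: a new letter commutes to its block, and
  \<open>y^q = y\<close> keeps the exponent below \<open>q\<close>. The last conjunct ensures that a
  nonempty word does not reduce to the meaningless empty product.\<close>

lemma eqv_y_block:
  "\<exists>m r. (\<forall>i. r i < CARD('f)) \<and> eqv (map y_var us) (y_block r [0..<m]) \<and> (us \<noteq> [] \<longrightarrow> (\<exists>i<m. 0 < r i))"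
proof (induction us)
  case Nil
  have "eqv (map y_var []) (y_block (\<lambda>_. 0) [0..<0])" by simp
  then show ?case using CARD_gt_1 by (intro exI[of _ 0] exI[of _ "\<lambda>_. 0"]) simp
next
  case (Cons a us)
  then obtain m r where r: "\<forall>i. r i < CARD('f)" "eqv (map y_var us) (y_block r [0..<m])" by blast
  \<comment> \<open>\<open>M\<close> extends the range to contain \<open>a\<close>;
    \<open>r'\<close> pads with zeros because \<open>r\<close> may be nonzero from \<open>m\<close>
    on.\<close>
  define M where "M = max m (Suc a)"
  define r' where "r' i = (if i < m then r i else 0)" for i
  \<comment> \<open>An exponent that would reach \<open>q\<close> drops to 1 and not to 0, since
    \<open>y^q\<close> reduces to \<open>y\<close>.\<close>
  define s where "s = r'(a := if Suc (r' a) < CARD('f) then Suc (r' a) else 1)"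
  let ?P = "y_block r' [0..<a] :: 'f free_algebra list"
  let ?Q = "y_block r' [Suc a..<M] :: 'f free_algebra list"
  have P: "set ?P \<subseteq> free_even" by (auto simp: free_var_graded set_replicate_conv_if)
  have split: "[0..<M] = [0..<a] @ a # [Suc a..<M]"
    using upt_add_eq_append[of 0 a "M - a"] upt_conv_Cons[of a M] by (simp add: M_def)
  have "[0..<M] = [0..<m] @ [m..<M]"
    using upt_add_eq_append[of 0 m "M - m"] by (simp add: M_def)
  moreover have "y_block r [0..<m] = (y_block r' [0..<m] :: 'f free_algebra list)"
    by (rule y_block_cong) (simp add: r'_def)
  moreover have "y_block r' [m..<M] = ([] :: 'f free_algebra list)" by (simp add: r'_def)
  ultimately have "y_block r [0..<m] = (y_block r' [0..<M] :: 'f free_algebra list)"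
    by (simp only: map_append concat_append append_Nil2)
  also have "\<dots> = ?P @ replicate (r' a) (y_var a) @ ?Q" by (simp add: split)
  finally have "eqv (map y_var (a # us)) (y_var a # ?P @ replicate (r' a) (y_var a) @ ?Q)"
    using eqv_Cons[OF r(2)] by simp
  also have "eqv \<dots> (?P @ replicate (Suc (r' a)) (y_var a) @ ?Q)"
    using eqv_context[OF eqv_move[OF free_var_graded(1) P], of "[]" a "replicate (r' a) (y_var a) @ ?Q"]
    by simp
  also have "eqv \<dots> (?P @ replicate (s a) (y_var a) @ ?Q)"
  proof (cases "Suc (r' a) < CARD('f)")
    case False
    moreover have "r' a < CARD('f)" using r(1) by (simp add: r'_def)
    ultimately have "Suc (r' a) = CARD('f)" by linarith
    moreover have "replicate (s a) (y_var a) = [y_var a :: 'f free_algebra]"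
      using False by (simp add: s_def)
    ultimately show ?thesis
      using eqv_context[OF eqv_power[of "y_var a"], of ?P ?Q]
      by (simp add: free_var_graded del: replicate_Suc)
  qed (simp add: s_def)
  also have "?P = y_block s [0..<a]" by (rule y_block_cong) (simp add: s_def)
  also have "?Q = y_block s [Suc a..<M]" by (rule y_block_cong) (simp add: s_def)
  also have "y_block s [0..<a] @ replicate (s a) (y_var a) @ y_block s [Suc a..<M] =
      (y_block s [0..<M] :: 'f free_algebra list)"
    by (simp add: split)
  finally have "eqv (map y_var (a # us)) (y_block s [0..<M])" .
  moreover have "\<forall>i. s i < CARD('f)" using r(1) CARD_gt_1 by (auto simp: s_def r'_def)
  moreover have "a < M \<and> 0 < s a" by (simp add: M_def s_def)
  ultimately show ?case by blast
qed

section \<open>Spanning by the listed polynomials\<close>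

definition reducible :: "'f free_algebra set" where
  "reducible = {f. \<exists>g\<in>free.span (basis_polys CARD('f)). f - g \<in> I}"

lemma reducible_congruent:
  assumes "f - g \<in> I" "g \<in> reducible" shows "f \<in> reducible"
proof -
  from assms(2) obtain h where h: "h \<in> free.span (basis_polys CARD('f))" "g - h \<in> I"
    by (auto simp: reducible_def)
  have "f - h \<in> I" using free.subspace_add[OF I_subspace assms(1) h(2)] by simp
  with h(1) show ?thesis by (auto simp: reducible_def)
qed

lemma reducible_I: "f \<in> I \<Longrightarrow> f \<in> reducible"
  unfolding reducible_def by (auto intro!: bexI[of _ 0] simp: free.span_zero)

lemma reducible_add:
  assumes "f \<in> reducible" "g \<in> reducible" shows "f + g \<in> reducible"
proof -
  from assms obtain f' g' where h: "f' \<in> free.span (basis_polys CARD('f))" "f - f' \<in> I"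
    "g' \<in> free.span (basis_polys CARD('f))" "g - g' \<in> I"
    by (auto simp: reducible_def)
  have "(f + g) - (f' + g') \<in> I"
    using free.subspace_add[OF I_subspace h(2,4)] by (simp add: algebra_simps)
  then show ?thesis using free.span_add[OF h(1,3)] unfolding reducible_def by blast
qed

lemma reducible_scale:
  assumes "f \<in> reducible" shows "free_scale c f \<in> reducible"
proof -
  from assms obtain f' where h: "f' \<in> free.span (basis_polys CARD('f))" "f - f' \<in> I"
    by (auto simp: reducible_def)
  have "free_scale c f - free_scale c f' \<in> I"
    using free.subspace_scale[OF I_subspace h(2), of c] by (simp add: free.scale_right_diff_distrib)
  then show ?thesis using free.span_scale[OF h(1)] unfolding reducible_def by blast
qed

lemma reducible_basis_poly:
  assumes "\<forall>i. r i < CARD('f)" "\<forall>i<n. s i < CARD('f)" "\<theta> = 1 \<or> \<theta> = 0 \<and> (\<exists>i<m. 0 < r i)"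
  shows "nprod (y_block r [0..<m] @ replicate \<theta> (z_commutator n s j)) \<in> reducible"
proof -
  have "1 \<le> (\<Sum>i<m. r i) + \<theta>"
    using assms(3) by (auto simp: Suc_le_eq sum_pos2 intro: sum_pos2)
  moreover have "nprod (y_block r [0..<m] @ replicate \<theta> (z_commutator n s j)) =
      basis_poly m r j n (\<lambda>i. i) s \<theta>"
    by (simp add: basis_poly_def z_commutator_def)
  ultimately have "nprod (y_block r [0..<m] @ replicate \<theta> (z_commutator n s j)) \<in> basis_polys CARD('f)"
    unfolding basis_polys_def
    by (intro CollectI exI conjI) (use assms in \<open>auto simp: strict_mono_on_def\<close>)
  then show ?thesis
    unfolding reducible_def
    by (auto intro!: bexI free.span_base simp: free.subspace_0[OF I_subspace])
qed

lemma reducible_y_word: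
  assumes "us \<noteq> []" shows "nprod (map y_var us) \<in> reducible"
proof -
  obtain m r where r: "\<forall>i. r i < CARD('f)" "eqv (map y_var us) (y_block r [0..<m])" "\<exists>i<m. 0 < r i"
    using eqv_y_block[of us] assms by blast
  have "nprod (map y_var us) - nprod (y_block r [0..<m]) \<in> I"
    using r(2)[unfolded eqv_def, rule_format, of "[]" "[]"] by simp
  then show ?thesis
    using reducible_basis_poly[OF r(1), of 0 "\<lambda>_. 0" 0 m] r(3) by (auto intro: reducible_congruent)
qed

lemma reducible_z_commutator:
  assumes "\<forall>i<n. s i < CARD('f)" shows "nprod (map y_var us @ [z_commutator n s j]) \<in> reducible"
proof -
  obtain m r where r: "\<forall>i. r i < CARD('f)" "eqv (map y_var us) (y_block r [0..<m])"
    using eqv_y_block[of us] by blast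
  have "nprod (map y_var us @ [z_commutator n s j]) - nprod (y_block r [0..<m] @ [z_commutator n s j]) \<in> I"
    using r(2)[unfolded eqv_def, rule_format, of "[]" "[z_commutator n s j]"] by simp
  then show ?thesis
    using reducible_basis_poly[OF r(1) assms, of 1 m j] by (auto intro: reducible_congruent)
qed

text \<open>The variables to the right of \<open>z\<^sub>j\<close> are absorbed one at a time by \<open>w y = y w + [w, y]\<close>. The
  exponents in the commutator stay below \<open>q = CARD('f)\<close>, since \<open>y\<^sub>k\<close> is absorbed at most \<open>b k < q\<close> times.\<close>

lemma reducible_absorb:
  assumes b: "\<forall>i. b i < CARD('f)" and "k \<le> n" "\<forall>i<k. s i < CARD('f)"
  shows "nprod (map y_var us @ z_commutator k s j # y_block b [k..<n]) \<in> reducible"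
  using assms(2,3)
proof (induction k arbitrary: s us rule: inc_induct)
  case base
  then show ?case using reducible_z_commutator by simp
next
  case (step k)
  let ?D = "\<lambda>x. commutator x (y_var k)"
  \<comment> \<open>Here \<open>i\<close> copies of \<open>y_k\<close> are already in the commutator
    and \<open>t\<close> wait to its right. Each rewriting lowers \<open>t\<close> and never raises
    \<open>i + t\<close>; one summand lengthens the prefix, so \<open>us\<close> must vary.\<close>
  have *: "nprod (map y_var us @ (?D ^^ i) (z_commutator k s j) #
      replicate t (y_var k) @ y_block b [Suc k..<n]) \<in> reducible" if "i + t < CARD('f)" for i t us
    using that
  proof (induction t arbitrary: i us)
    case 0
    \<comment> \<open>No copy of \<open>y_k\<close> is left on the right: its count \<open>i\<close>
      is stored in \<open>s\<close> at \<open>k\<close>, and the outer induction continues with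
      \<open>Suc k\<close>.\<close>
    have "nprod (map y_var us @ z_commutator (Suc k) (s(k := i)) j # y_block b [Suc k..<n]) \<in> reducible"
      using step.prems 0 by (intro step.IH) (auto simp: less_Suc_eq)
    then show ?case by (simp add: z_commutator_Suc)
  next
    case (Suc t)
    let ?w = "(?D ^^ i) (z_commutator k s j)" and ?B = "replicate t (y_var k) @ y_block b [Suc k..<n]"
    have "nprod (map y_var us @ ?w # y_var k # ?B) =
        nprod (map y_var (us @ [k]) @ ?w # ?B) + nprod (map y_var us @ ?D ?w # ?B)"
      using nprod_move_right[of "map y_var us" ?w "y_var k" ?B] by simp
    also have "\<dots> \<in> reducible"
      using Suc.prems Suc.IH[of i "us @ [k]"] Suc.IH[of "Suc i" us] by (intro reducible_add) auto
    finally show ?case by simp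
  qed
  from *[of 0 "b k" us] show ?case using b step.hyps by (simp add: upt_conv_Cons)
qed

text \<open>Sorting the letters to the right of \<open>z_j\<close> first bounds their exponents;
  absorption then starts at \<open>k = 0\<close>, where the commutator is \<open>z_j\<close>
  itself.\<close>

lemma reducible_z_word: "nprod (map y_var us @ z_var j # map y_var vs) \<in> reducible"
proof -
  obtain n b where b: "\<forall>i. b i < CARD('f)" "eqv (map y_var vs) (y_block b [0..<n])"
    using eqv_y_block[of vs] by blast
  have "nprod (map y_var us @ z_var j # map y_var vs) - nprod (map y_var us @ z_var j # y_block b [0..<n]) \<in> I"
    using b(2)[unfolded eqv_def, rule_format, of "map y_var us @ [z_var j]" "[]"] by simp
  then show ?thesis
    using reducible_absorb[OF b(1), of 0 n "\<lambda>_. 0" us j] by (auto intro: reducible_congruent)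
qed

text \<open>The letters \<open>y\<close> in between are counted to the first factor, which stays
  odd, so the block is a product of two odd elements.\<close>

lemma zz_word: "nprod (A @ z_var i # map y_var us @ z_var j # B) \<in> I"
proof -
  have "nprod (map free_var (Z i # map Y us)) \<in> (free_odd :: 'f free_algebra set)"
    using free.nprod_graded[of free_var "Z i # map Y us"]
    by (simp add: free_var_graded z_degree_def)
  then have "nprod (z_var i # map y_var us) * z_var j \<in> I"
    by (intro odd_mult) (simp_all add: free_var_graded comp_def)
  then have "nprod (z_var i # map y_var us @ [z_var j]) \<in> I"
    using nprod_append[of "(z_var i :: 'f free_algebra) # map y_var us" "[z_var j]"] by simp
  from I_nprod[OF this, of A B] show ?thesis
    using nprod_collapse[of "z_var i # map y_var us @ [z_var j]" A B] by simp
qed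

lemma reducible_all: "f \<in> reducible"
proof (induction f rule: free_algebra_induct)
  case zero
  show ?case using free.subspace_0[OF I_subspace] by (rule reducible_I)
next
  case (add f g)
  then show ?case by (rule reducible_add)
next
  case (monomial c l)
  have "nprod (map free_var l) \<in> reducible"
  proof -
    \<comment> \<open>Splitting at the first \<open>z\<close>, and once more in the remainder,
      separates words with no, one and at least two letters \<open>z\<close>.\<close>
    consider us where "l = map Y us" | us j vs where "l = map Y us @ Z j # map Y vs"
      | us i vs j l' where "l = map Y us @ Z i # map Y vs @ Z j # l'"
      using word_split_Z by metis
    then show ?thesis
    proof cases
      case 1
      then show ?thesis using reducible_y_word[of us] monomial by (simp add: comp_def)
    next
      case 2
      then show ?thesis using reducible_z_word by (simp add: comp_def)
    next
      case 3
      then show ?thesis using reducible_I[OF zz_word] by (simp add: comp_def)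
    qed
  qed
  then show ?case by (rule reducible_scale)
qed

end


section \<open>Independence of the basis\<close>

text \<open>Induction on the variables: with the others fixed, a vanishing combination is a
  polynomial of degree below \<open>q\<close> in one variable with \<open>q\<close> roots, so each
  of its coefficients vanishes.\<close>

lemma reduced_monomials_independent:
  fixes u :: "'k \<Rightarrow> 'f::{field,finite}" and e :: "'k \<Rightarrow> 'i \<Rightarrow> nat"
  assumes "finite V" "finite K"
    and "\<And>k i. k \<in> K \<Longrightarrow> i \<in> V \<Longrightarrow> e k i < CARD('f)"
    and "\<And>k l. k \<in> K \<Longrightarrow> l \<in> K \<Longrightarrow> (\<And>i. i \<in> V \<Longrightarrow> e k i = e l i) \<Longrightarrow> k = l"
    and "\<And>x. (\<Sum>k\<in>K. u k * (\<Prod>i\<in>V. x i ^ e k i)) = 0"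
    and "k \<in> K"
  shows "u k = 0"
  using assms
proof (induction V arbitrary: K k rule: finite_induct)
  case empty
  \<comment> \<open>Without variables all exponent vectors coincide, so the vanishing sum consists
    of the single term \<open>u k\<close>.\<close>
  then have "K = {k}" by blast
  then show ?case using empty.prems(4)[of undefined] by simp
next
  case (insert v V)
  \<comment> \<open>The terms sharing with \<open>k\<close> the exponent of \<open>v\<close>:
    together they form one coefficient of the polynomial in the variable \<open>v\<close>.\<close>
  let ?K = "{l \<in> K. e l v = e k v}"
  have "(\<Sum>l\<in>?K. u l * (\<Prod>i\<in>V. x i ^ e l i)) = 0" for x
  proof -
    define c where "c l = u l * (\<Prod>i\<in>V. x i ^ e l i)" for l
    define p where "p = (\<Sum>l\<in>K. monom (c l) (e l v))"
    have "poly p y = 0" for y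
    proof -
      have "(\<Prod>i\<in>V. (x(v := y)) i ^ e l i) = (\<Prod>i\<in>V. x i ^ e l i)" for l
        using insert.hyps(2) by (intro prod.cong) auto
      then have "poly p y = (\<Sum>l\<in>K. u l * (\<Prod>i\<in>insert v V. (x(v := y)) i ^ e l i))"
        unfolding p_def c_def using insert.hyps
        by (simp add: poly_sum poly_monom prod.insert mult_ac)
      then show ?thesis using insert.prems(4) by simp
    qed
    moreover have "degree p < CARD('f)"
      unfolding p_def
    proof (rule degree_sum_less)
      fix l assume "l \<in> K"
      then have "e l v < CARD('f)" using insert.prems(2) by blast
      then show "degree (monom (c l) (e l v)) < CARD('f)"
        using degree_monom_le[of "c l" "e l v"] by linarith
    qed simp
    ultimately have "p = 0" using card_poly_roots_bound[of p] by fastforce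
    then have "0 = coeff p (e k v)" by simp
    also have "\<dots> = (\<Sum>l\<in>K. if e l v = e k v then c l else 0)"
      by (simp add: p_def coeff_sum)
    also have "\<dots> = (\<Sum>l\<in>?K. c l)"
      using insert.prems(1) by (simp add: sum.inter_filter)
    finally show ?thesis by (simp add: c_def)
  qed
  moreover have "l = l'" if "l \<in> ?K" "l' \<in> ?K" "\<And>i. i \<in> V \<Longrightarrow> e l i = e l' i" for l l'
    using that by (intro insert.prems(3)) auto
  ultimately show ?case
    using insert.prems(1,2,5) by (intro insert.IH[of ?K]) auto
qed

section \<open>Parametrisation of the listed polynomials without repetition\<close>

definition support_list :: "(nat \<Rightarrow> nat) \<Rightarrow> nat list" where
  "support_list r = sorted_list_of_set {i. r i \<noteq> 0}"

definition monomial_value :: "(nat \<Rightarrow> nat) \<Rightarrow> (nat \<Rightarrow> 'f::field) \<Rightarrow> 'f" where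
  "monomial_value r a = (\<Prod>i | r i \<noteq> 0. a i ^ r i)"

text \<open>Different parameters of \<^const>\<open>basis_poly\<close> may give the same polynomial. A key
  \<open>(r, None)\<close> or \<open>(r, Some (j, s))\<close>, where \<open>r\<close> and \<open>s\<close> are the exponents as finitely
  supported functions on the indices, corresponds to exactly one polynomial.\<close>

type_synonym key = "(nat \<Rightarrow> nat) \<times> (nat \<times> (nat \<Rightarrow> nat)) option"

text \<open>The zero exponents for \<open>None\<close> make the factor in \<open>d\<close> equal to
  1, so one formula for \<open>key_value\<close> serves both kinds of keys.\<close>

fun commutator_exponents :: "key \<Rightarrow> nat \<Rightarrow> nat" where
  "commutator_exponents (r, None) = (\<lambda>_. 0)"
| "commutator_exponents (r, Some (j, s)) = s"

definition reduced_exponents :: "nat \<Rightarrow> (nat \<Rightarrow> nat) set" where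
  "reduced_exponents q = {r. finite {i. r i \<noteq> 0} \<and> (\<forall>i. r i < q)}"

text \<open>The last condition excludes the key of the empty product, whose value 0 is a
  dummy.\<close>

definition basis_keys :: "nat \<Rightarrow> key set" where
  "basis_keys q = {k. fst k \<in> reduced_exponents q \<and> commutator_exponents k \<in> reduced_exponents q \<and>
     (snd k = None \<longrightarrow> fst k \<noteq> (\<lambda>_. 0))}"

fun key_poly :: "key \<Rightarrow> 'f::field free_algebra" where
  "key_poly (r, None) = nprod (y_block r (support_list r))"
| "key_poly (r, Some (j, s)) = nprod (y_block r (support_list r) @
     [commutator_powers (z_var j) (map (\<lambda>i. (y_var i, s i)) (support_list s))])"

lemma support_list_eqI:
  assumes "sorted_wrt (<) xs" "set xs = {i. r i \<noteq> 0}"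
  shows "support_list r = xs"
  unfolding support_list_def assms(2)[symmetric]
  using assms(1) by (simp add: sorted_list_of_set.idem_if_sorted_distinct strict_sorted_iff)

lemma concat_map_filter:
  "(\<And>x. x \<in> set xs \<Longrightarrow> \<not> P x \<Longrightarrow> f x = []) \<Longrightarrow> concat (map f (filter P xs)) = concat (map f xs)"
  by (induction xs) auto

lemma commutator_powers_filter:
  "commutator_powers u (filter (\<lambda>(v, r). r \<noteq> 0) vs) = commutator_powers u vs"
  unfolding commutator_powers_def by (induction vs arbitrary: u) auto

text \<open>Dropping zero exponents and recording the others by variable index yields a normal form
  of the parameters.\<close>

lemma basis_poly_key:
  assumes "strict_mono_on {..<n} js" "\<forall>i<m. r i < q" "\<forall>i<n. s i < q" "0 < q"
    "\<theta> \<in> {0, 1}" "(\<Sum>i<m. r i) + \<theta> \<ge> 1"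
  shows "\<exists>k\<in>basis_keys q. basis_poly m r j n js s \<theta> = (key_poly k :: 'f::field free_algebra)"
proof -
  \<comment> \<open>Cut off at \<open>m\<close>, since \<open>basis_poly\<close> ignores the later
    values of \<open>r\<close>.\<close>
  define R where "R i = (if i < m then r i else 0)" for i
  have "support_list R = filter (\<lambda>i. r i \<noteq> 0) [0..<m]"
    by (rule support_list_eqI) (auto simp: R_def sorted_wrt_filter)
  then have "y_block R (support_list R) = (y_block R [0..<m] :: 'f free_algebra list)"
    by (simp add: concat_map_filter R_def)
  also have "\<dots> = y_block r [0..<m]"
    by (rule y_block_cong) (simp add: R_def)
  finally have y: "y_block r [0..<m] = (y_block R (support_list R) :: 'f free_algebra list)" ..
  have R: "R \<in> reduced_exponents q"
    using assms(2,4) finite_subset[of "{i. R i \<noteq> 0}" "{..<m}"]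
    by (auto simp: reduced_exponents_def R_def)
  have inj: "inj_on js {..<n}" using assms(1) by (rule strict_mono_on_imp_inj_on)
  \<comment> \<open>Reindexes the exponents from positions in the commutator to variable indices,
    along the injective \<open>js\<close>.\<close>
  define S where "S k = (if k \<in> js ` {..<n} then s (the_inv_into {..<n} js k) else 0)" for k
  have S_js: "S (js i) = s i" if "i < n" for i
    using that by (simp add: S_def the_inv_into_f_f[OF inj])
  have "sorted_wrt (<) (map js (filter (\<lambda>i. s i \<noteq> 0) [0..<n]))"
    unfolding sorted_wrt_map
    by (rule sorted_wrt_mono_rel[OF _ sorted_wrt_filter[OF sorted_wrt_upt]])
      (use assms(1) in \<open>auto simp: strict_mono_on_def\<close>)
  moreover have "set (map js (filter (\<lambda>i. s i \<noteq> 0) [0..<n])) = {k. S k \<noteq> 0}"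
  proof -
    have "S k \<noteq> 0 \<longleftrightarrow> (\<exists>i<n. k = js i \<and> s i \<noteq> 0)" for k
    proof (cases "k \<in> js ` {..<n}")
      case True
      then obtain i where "i < n" "k = js i" by blast
      then show ?thesis using S_js inj by (metis inj_onD lessThan_iff)
    qed (auto simp: S_def)
    then show ?thesis by auto
  qed
  ultimately have supp: "support_list S = map js (filter (\<lambda>i. s i \<noteq> 0) [0..<n])"
    by (rule support_list_eqI)
  have "map (\<lambda>i. (y_var i :: 'f free_algebra, S i)) (support_list S) =
      filter (\<lambda>(v, r). r \<noteq> 0) (map (\<lambda>i. (y_var (js i), s i)) [0..<n])"
    by (simp add: supp filter_map comp_def S_js)
  then have z: "commutator_powers (z_var j) (map (\<lambda>i. (y_var (js i), s i)) [0..<n]) =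
      (commutator_powers (z_var j) (map (\<lambda>i. (y_var i, S i)) (support_list S)) :: 'f free_algebra)"
    by (simp only: commutator_powers_filter)
  have "finite {i. S i \<noteq> 0}"
    by (rule finite_subset[of _ "js ` {..<n}"]) (auto simp: S_def)
  then have S: "S \<in> reduced_exponents q"
    using assms(3,4) by (auto simp: reduced_exponents_def S_def the_inv_into_f_f[OF inj])
  from assms(5) consider "\<theta> = 0" | "\<theta> = 1" by blast
  then show ?thesis
  proof cases
    case 1
    have "R \<noteq> (\<lambda>_. 0)"
    proof
      assume "R = (\<lambda>_. 0)"
      then have "r i = 0" if "i < m" for i using that by (metis R_def)
      then show False using assms(6) 1 by simp
    qed
    then have "(R, None) \<in> basis_keys q"
      using R \<open>0 < q\<close> by (auto simp: basis_keys_def reduced_exponents_def)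
    moreover have "basis_poly m r j n js s \<theta> = (key_poly (R, None) :: 'f free_algebra)"
      using 1 by (simp add: basis_poly_def y)
    ultimately show ?thesis by blast
  next
    case 2
    have "(R, Some (j, S)) \<in> basis_keys q" using R S by (simp add: basis_keys_def)
    moreover have "basis_poly m r j n js s \<theta> = (key_poly (R, Some (j, S)) :: 'f free_algebra)"
      using 2 by (simp add: basis_poly_def y z)
    ultimately show ?thesis by blast
  qed
qed

text \<open>Through this inclusion the listed polynomials inherit injectivity and independence from
  the family of all keys.\<close>

lemma basis_polys_keys: "0 < q \<Longrightarrow> basis_polys q \<subseteq> key_poly ` basis_keys q"
  unfolding basis_polys_def using basis_poly_key by blast

section \<open>Evaluation in upper triangular matrices\<close>

definition ut2_mat :: "'f::field \<Rightarrow> 'f \<Rightarrow> 'f \<Rightarrow> 'f ut2" where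
  "ut2_mat a b d = ut2_scale a e11 + ut2_scale b e12 + ut2_scale d e22"

lemma ut2_mat_mult:
  "ut2_mat a b d * ut2_mat a' b' d' = ut2_mat (a * a') (a * b' + b * d') (d * d')"
  unfolding ut2_mat_def by transfer (auto simp: vec_eq_iff forall_2 matrix_matrix_mult_def sum_2)

lemma ut2_mat_diff: "ut2_mat a b d - ut2_mat a' b' d' = ut2_mat (a - a') (b - b') (d - d')"
  unfolding ut2_mat_def by transfer (auto simp: vec_eq_iff forall_2)

lemma ut2_mat_entries [simp]:
  "Rep_ut2 (ut2_mat a b d) $ 1 $ 1 = a"
  "Rep_ut2 (ut2_mat a b d) $ 1 $ 2 = b"
  "Rep_ut2 (ut2_mat a b d) $ 2 $ 2 = d"
  unfolding ut2_mat_def by (transfer, simp)+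

lemma ut2_mat_zero: "ut2_mat 0 0 0 = 0"
  by (simp add: ut2_mat_def)

lemma ut2_even_cases: "A \<in> ut2_even \<Longrightarrow> \<exists>a d. A = ut2_mat a 0 d"
  by (auto simp: ut2_even_def ut2.span_insert ut2_mat_def algebra_simps)

lemma ut2_odd_cases: "A \<in> ut2_odd \<Longrightarrow> \<exists>b. A = ut2_mat 0 b 0"
  by (auto simp: ut2_odd_def ut2.span_singleton ut2_mat_def)

lemma ut2_mat_commutator:
  "commutator (ut2_mat 0 c 0) (ut2_mat a 0 b) = ut2_mat 0 (c * (b - a)) 0"
  by (simp add: commutator_def ut2_mat_mult ut2_mat_diff algebra_simps)

text \<open>With lower diagonal entry \<open>a i + d i\<close>, bracketing with \<open>y_i\<close>
  multiplies an \<open>e12\<close> matrix by \<open>d i\<close>, while left multiplication by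
  \<open>y_i\<close> multiplies it by \<open>a i\<close>.\<close>

definition evaluation :: "(nat \<Rightarrow> 'f::field) \<Rightarrow> (nat \<Rightarrow> 'f) \<Rightarrow> (nat \<Rightarrow> 'f) \<Rightarrow> variable \<Rightarrow> 'f ut2" where
  "evaluation a d c v = (case v of Y i \<Rightarrow> ut2_mat (a i) 0 (a i + d i) | Z j \<Rightarrow> ut2_mat 0 (c j) 0)"

lemma evaluation_simps [simp]:
  "evaluation a d c (Y i) = ut2_mat (a i) 0 (a i + d i)"
  "evaluation a d c (Z j) = ut2_mat 0 (c j) 0"
  by (simp_all add: evaluation_def)

lemma evaluation_graded: "evaluation a d c (Y i) \<in> ut2_even" "evaluation a d c (Z i) \<in> ut2_odd"
  by (simp_all add: ut2_even_iff ut2_odd_iff)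

abbreviation ut2_eval where
  "ut2_eval a d c \<equiv> substitute ut2_scale (evaluation a d c)"

lemma eval_y_word:
  assumes "us \<noteq> []"
  shows "ut2_eval a d c (nprod (map y_var us)) =
    ut2_mat (\<Prod>i\<leftarrow>us. a i) 0 (\<Prod>i\<leftarrow>us. a i + d i)"
proof -
  have "ut2_eval a d c (nprod (map y_var us)) = nprod (map (\<lambda>i. ut2_mat (a i) 0 (a i + d i)) us)"
    using ut2.substitute_word[of "map Y us" "evaluation a d c"] assms
    by (simp add: comp_def)
  also have "\<dots> = ut2_mat (\<Prod>i\<leftarrow>us. a i) 0 (\<Prod>i\<leftarrow>us. a i + d i)"
    using assms by (induction us rule: induct_list012) (auto simp: ut2_mat_mult)
  finally show ?thesis .
qed

lemma eval_commutator_powers: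
  assumes "ut2_eval a d c w = ut2_mat 0 t 0"
  shows "ut2_eval a d c (commutator_powers w (map (\<lambda>i. (y_var i, s i)) is)) =
    ut2_mat 0 (t * (\<Prod>i\<leftarrow>is. d i ^ s i)) 0"
  using assms
proof (induction "is" arbitrary: w t)
  case Nil
  then show ?case by (simp add: commutator_powers_def)
next
  case (Cons i "is")
  have "ut2_eval a d c (((\<lambda>x. commutator x (y_var i)) ^^ n) w) = ut2_mat 0 (t * d i ^ n) 0" for n
  proof (induction n)
    case (Suc n)
    have "ut2_eval a d c (commutator x y) = commutator (ut2_eval a d c x) (ut2_eval a d c y)" for x y
      by (simp add: commutator_def ut2.substitute_diff ut2.substitute_mult)
    then show ?case using Suc by (simp add: ut2_mat_commutator mult_ac)
  qed (simp add: Cons.prems)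
  from Cons.IH[OF this] show ?case by (simp add: commutator_powers_def mult_ac)
qed

lemma prod_list_support:
  assumes "finite {i. r i \<noteq> 0}"
  shows "(\<Prod>i\<leftarrow>support_list r. a i ^ r i) = monomial_value r a"
  using assms by (simp add: support_list_def monomial_value_def prod.distinct_set_conv_list[symmetric])

lemma y_block_word: "y_block r is = map y_var (concat (map (\<lambda>i. replicate (r i) i) is))"
  by (induction "is") auto

lemma prod_list_y_block:
  "(\<Prod>i\<leftarrow>concat (map (\<lambda>i. replicate (r i) i) is). a i) = (\<Prod>i\<leftarrow>is. (a i :: 'f::field) ^ r i)"
  by (induction "is") (auto simp: prod_list_replicate)

definition key_value :: "key \<Rightarrow> (nat \<Rightarrow> 'f::field) \<Rightarrow> (nat \<Rightarrow> 'f) \<Rightarrow> 'f" where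
  "key_value k a d = monomial_value (fst k) a * monomial_value (commutator_exponents k) d"

text \<open>Products of letters \<open>y\<close> become diagonal, products ending in a commutator
  become multiples of \<open>e12\<close>; so the two entries separate the two kinds of keys.\<close>

lemma eval_key_poly:
  assumes "k \<in> basis_keys q"
  shows "Rep_ut2 (ut2_eval a d c (key_poly k)) $ 1 $ 1 = (if snd k = None then key_value k a d else 0)"
    and "Rep_ut2 (ut2_eval a d c (key_poly k)) $ 1 $ 2 =
      (case snd k of None \<Rightarrow> 0 | Some (j, s) \<Rightarrow> c j * key_value k a d)"
proof -
  obtain r k' where k: "k = (r, k')" by (cases k)
  let ?us = "concat (map (\<lambda>i. replicate (r i) i) (support_list r))"
  have fin: "finite {i. r i \<noteq> 0}"
    using assms by (auto simp: k basis_keys_def reduced_exponents_def)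
  have prod: "(\<Prod>i\<leftarrow>?us. a i) = monomial_value r a" for a :: "nat \<Rightarrow> 'a"
    using fin by (simp only: prod_list_y_block prod_list_support)
  have "(Rep_ut2 (ut2_eval a d c (key_poly k)) $ 1 $ 1 = (if snd k = None then key_value k a d else 0)) \<and>
    Rep_ut2 (ut2_eval a d c (key_poly k)) $ 1 $ 2 =
      (case snd k of None \<Rightarrow> 0 | Some (j, s) \<Rightarrow> c j * key_value k a d)"
  proof (cases k')
    case None
    then have "r \<noteq> (\<lambda>_. 0)" using assms by (auto simp: k basis_keys_def)
    then obtain i where "r i \<noteq> 0" by auto
    \<comment> \<open>A nonempty word is essential: the dummy empty product would evaluate to 0 and
      not to the identity matrix.\<close>
    then have "?us \<noteq> []" using fin by (auto simp: support_list_def)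
    then show ?thesis
      using None by (simp add: k y_block_word eval_y_word prod key_value_def monomial_value_def[of "\<lambda>_. 0"] del: concat_eq_Nil_conv)
  next
    case (Some js)
    obtain j s where js: "js = (j, s)" by (cases js)
    define w :: "'a free_algebra" where
      "w = commutator_powers (z_var j) (map (\<lambda>i. (y_var i, s i)) (support_list s))"
    have "finite {i. s i \<noteq> 0}"
      using assms by (auto simp: k Some js basis_keys_def reduced_exponents_def)
    then have w: "ut2_eval a d c w = ut2_mat 0 (c j * monomial_value s d) 0"
      unfolding w_def
      by (subst eval_commutator_powers[where t = "c j"]) (simp_all add: prod_list_support)
    have "ut2_eval a d c (nprod (map y_var ?us @ [w])) =
        ut2_mat 0 (monomial_value r a * (c j * monomial_value s d)) 0"
    proof (cases "?us = []")
      case True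
      \<comment> \<open>With no letter \<open>y\<close> the left factor is absent, so
        multiplicativity of \<open>nprod\<close> cannot be applied.\<close>
      then have "monomial_value r a = 1" using prod[of a] by (metis list.map(1) prod_list.Nil)
      then show ?thesis by (simp only: True list.map append_Nil nprod.simps w) simp
    next
      case False
      then show ?thesis
        by (simp add: nprod_append ut2.substitute_mult eval_y_word w ut2_mat_mult prod del: concat_eq_Nil_conv)
    qed
    then show ?thesis by (simp add: k Some js y_block_word key_value_def mult_ac flip: w_def)
  qed
  then show "Rep_ut2 (ut2_eval a d c (key_poly k)) $ 1 $ 1 = (if snd k = None then key_value k a d else 0)"
    "Rep_ut2 (ut2_eval a d c (key_poly k)) $ 1 $ 2 =
      (case snd k of None \<Rightarrow> 0 | Some (j, s) \<Rightarrow> c j * key_value k a d)" by blast+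
qed

text \<open>The values forget the index of \<open>z\<close>, hence the assumption
  \<open>same\<close>; under it the exponents in \<open>a\<close> and \<open>d\<close> determine the
  key, and reduced monomials are independent.\<close>

lemma key_values_independent:
  fixes u :: "key \<Rightarrow> 'f::{field,finite}"
  assumes "finite K" "K \<subseteq> basis_keys CARD('f)"
    and same: "\<And>k l. k \<in> K \<Longrightarrow> l \<in> K \<Longrightarrow> map_option fst (snd k) = map_option fst (snd l)"
    and zero: "\<And>a d. (\<Sum>k\<in>K. u k * key_value k a d) = 0"
    and "k \<in> K"
  shows "u k = 0"
proof -
  \<comment> \<open>Finitely many indices occur. In \<open>V <+> V\<close> the left copy carries the
    variables \<open>a i\<close>, the right copy the \<open>d i\<close>.\<close>
  define V where "V = (\<Union>k\<in>K. {i. fst k i \<noteq> 0} \<union> {i. commutator_exponents k i \<noteq> 0})"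
  define e where "e k = case_sum (fst k) (commutator_exponents k)" for k
  have K: "fst k \<in> reduced_exponents CARD('f)" "commutator_exponents k \<in> reduced_exponents CARD('f)"
    if "k \<in> K" for k
    using that assms(2) by (auto simp: basis_keys_def)
  have V: "finite V" unfolding V_def using \<open>finite K\<close> K by (auto simp: reduced_exponents_def)
  have val: "key_value k (\<lambda>i. x (Inl i)) (\<lambda>i. x (Inr i)) = (\<Prod>i\<in>V <+> V. x i ^ e k i)"
    if "k \<in> K" for k and x :: "nat + nat \<Rightarrow> 'f"
  proof -
    have "monomial_value r a = (\<Prod>i\<in>V. a i ^ r i)" if "{i. r i \<noteq> 0} \<subseteq> V" for r and a :: "nat \<Rightarrow> 'f"
      unfolding monomial_value_def using V that by (intro prod.mono_neutral_left) auto
    moreover have "{i. fst k i \<noteq> 0} \<subseteq> V" "{i. commutator_exponents k i \<noteq> 0} \<subseteq> V"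
      using that by (auto simp: V_def)
    ultimately show ?thesis using V by (simp add: key_value_def prod.Plus e_def)
  qed
  show ?thesis
  proof (rule reduced_monomials_independent[of "V <+> V" K e u k])
    fix k i assume "k \<in> K" "i \<in> V <+> V"
    then show "e k i < CARD('f)"
      using K[of k] by (cases i) (auto simp: e_def reduced_exponents_def)
  next
    fix k l assume kl: "k \<in> K" "l \<in> K" and e: "\<And>i. i \<in> V <+> V \<Longrightarrow> e k i = e l i"
    have "fst k i = fst l i" for i
    proof (cases "i \<in> V")
      case True
      then show ?thesis using e[of "Inl i"] by (auto simp: e_def)
    qed (use kl in \<open>auto simp: V_def\<close>)
    moreover have "commutator_exponents k i = commutator_exponents l i" for i
    proof (cases "i \<in> V")
      case True
      then show ?thesis using e[of "Inr i"] by (auto simp: e_def)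
    qed (use kl in \<open>auto simp: V_def\<close>)
    ultimately have "fst k = fst l" "commutator_exponents k = commutator_exponents l" by auto
    then show "k = l" using same[OF kl]
      by (cases k rule: commutator_exponents.cases; cases l rule: commutator_exponents.cases) auto
  next
    fix x :: "nat + nat \<Rightarrow> 'f"
    show "(\<Sum>k\<in>K. u k * (\<Prod>i\<in>V <+> V. x i ^ e k i)) = 0"
      using zero[of "\<lambda>i. x (Inl i)" "\<lambda>i. x (Inr i)"] val by simp
  qed (use V assms in auto)
qed

lemma Rep_ut2_sum_scale:
  "Rep_ut2 (\<Sum>k\<in>K. ut2_scale (u k) (f k)) $ i $ j = (\<Sum>k\<in>K. u k * Rep_ut2 (f k) $ i $ j)"
  by (induction K rule: infinite_finite_induct)
    (auto simp: zero_ut2.rep_eq plus_ut2.rep_eq ut2_scale.rep_eq)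

text \<open>Every evaluation kills the combination; a suitable matrix entry and choice of
  \<open>c\<close> retain only the terms with the same \<open>z\<close> index as \<open>k\<close>,
  or those without \<open>z\<close>.\<close>

lemma key_polys_independent:
  fixes u :: "key \<Rightarrow> 'f::{field,finite}"
  assumes "finite K" "K \<subseteq> basis_keys CARD('f)"
    and "(\<Sum>k\<in>K. free_scale (u k) (key_poly k)) \<in> Id_gr_ut2"
    and "k \<in> K"
  shows "u k = 0"
proof -
  have sum: "(\<Sum>k\<in>K. u k * Rep_ut2 (ut2_eval a d c (key_poly k)) $ i $ j) = 0" for a d c i j
  proof -
    have "ut2_eval a d c (\<Sum>k\<in>K. free_scale (u k) (key_poly k)) = 0"
      using assms(3) evaluation_graded[of a d c] unfolding superidentities_def by blast
    then have "(\<Sum>k\<in>K. ut2_scale (u k) (ut2_eval a d c (key_poly k))) = 0"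
      by (simp add: ut2.substitute_sum ut2.substitute_scale)
    then show ?thesis by (simp add: zero_ut2.rep_eq flip: Rep_ut2_sum_scale)
  qed
  let ?L = "{l \<in> K. map_option fst (snd l) = map_option fst (snd k)}"
  have "(\<Sum>l\<in>?L. u l * key_value l a d) = 0" for a d
  proof (cases "snd k")
    case None
    have "(\<Sum>l\<in>?L. u l * key_value l a d) =
        (\<Sum>l\<in>K. u l * Rep_ut2 (ut2_eval a d (\<lambda>_. 0) (key_poly l)) $ 1 $ 1)"
      using assms(1,2) None
      by (intro sum.mono_neutral_cong_left) (auto simp: eval_key_poly(1)[OF subsetD[OF assms(2)]] simp del: key_poly.simps split: if_splits)
    then show ?thesis using sum by simp
  next
    case (Some js)
    \<comment> \<open>The indicator removes the commutators that start from another \<open>z\<close>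
      variable.\<close>
    let ?c = "\<lambda>j. if j = fst js then 1 else 0"
    have "(\<Sum>l\<in>?L. u l * key_value l a d) =
        (\<Sum>l\<in>K. u l * Rep_ut2 (ut2_eval a d ?c (key_poly l)) $ 1 $ 2)"
      using assms(1,2) Some
      by (intro sum.mono_neutral_cong_left)
        (auto simp: eval_key_poly(2)[OF subsetD[OF assms(2)]] simp del: key_poly.simps split: option.splits prod.splits)
    then show ?thesis using sum by simp
  qed
  then show ?thesis using assms by (intro key_values_independent[of ?L u k]) auto
qed


section \<open>The basis theorem\<close>

text \<open>Multiplication by \<open>x \<noteq> 0\<close> permutes the nonzero elements; comparing
  their products gives \<open>x ^ (q - 1) = 1\<close>.\<close>

lemma power_CARD:
  fixes x :: "'f::{field,finite}"
  shows "x ^ CARD('f) = x"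
proof (cases "x = 0")
  case False
  have "bij_betw ((*) x) (UNIV - {0}) (UNIV - {0})"
    by (rule bij_betwI[where g = "\<lambda>y. y / x"]) (use False in auto)
  then have "(\<Prod>y\<in>UNIV - {0}. x * y) = \<Prod>(UNIV - {0})"
    by (rule prod.reindex_bij_betw)
  then have "x ^ (CARD('f) - 1) = 1" by (simp add: prod.distrib)
  moreover have "CARD('f) = Suc (CARD('f) - 1)" by simp
  ultimately show ?thesis by (metis mult.right_neutral power_Suc)
qed simp

text \<open>Even matrices are diagonal, so they commute and satisfy \<open>x^q = x\<close>
  entrywise; odd ones are multiples of \<open>e12\<close>, whose square is 0.\<close>

lemma ut2_relations_superidentities: "ut2_relations (Id_gr_ut2 :: 'f::{field,finite} free_algebra set)"
proof
  show "T2_ideal (Id_gr_ut2 :: 'f free_algebra set)" by (rule ut2.T2_ideal_superidentities)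
next
  show "z_var 0 * z_var 1 \<in> (Id_gr_ut2 :: 'f free_algebra set)"
    unfolding superidentities_def
  proof (intro CollectI allI impI)
    fix \<sigma> :: "variable \<Rightarrow> 'f ut2"
    assume "(\<forall>i. \<sigma> (Y i) \<in> ut2_even) \<and> (\<forall>i. \<sigma> (Z i) \<in> ut2_odd)"
    then obtain b b' where "\<sigma> (Z 0) = ut2_mat 0 b 0" "\<sigma> (Z 1) = ut2_mat 0 b' 0"
      by (metis ut2_odd_cases)
    then show "substitute ut2_scale \<sigma> (z_var 0 * z_var 1) = 0"
      by (simp add: ut2.substitute_mult ut2_mat_mult ut2_mat_zero)
  qed
next
  show "commutator (y_var 0) (y_var 1) \<in> (Id_gr_ut2 :: 'f free_algebra set)"
    unfolding superidentities_def
  proof (intro CollectI allI impI)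
    fix \<sigma> :: "variable \<Rightarrow> 'f ut2"
    assume "(\<forall>i. \<sigma> (Y i) \<in> ut2_even) \<and> (\<forall>i. \<sigma> (Z i) \<in> ut2_odd)"
    then obtain a d a' d' where "\<sigma> (Y 0) = ut2_mat a 0 d" "\<sigma> (Y 1) = ut2_mat a' 0 d'"
      by (metis ut2_even_cases)
    then show "substitute ut2_scale \<sigma> (commutator (y_var 0) (y_var 1)) = 0"
      by (simp add: commutator_def ut2.substitute_diff ut2.substitute_mult ut2_mat_mult mult.commute)
  qed
next
  show "nprod (replicate CARD('f) (y_var 0)) - y_var 0 \<in> (Id_gr_ut2 :: 'f free_algebra set)"
    unfolding superidentities_def
  proof (intro CollectI allI impI)
    fix \<sigma> :: "variable \<Rightarrow> 'f ut2"
    assume "(\<forall>i. \<sigma> (Y i) \<in> ut2_even) \<and> (\<forall>i. \<sigma> (Z i) \<in> ut2_odd)"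
    then obtain a d where \<sigma>: "\<sigma> (Y 0) = ut2_mat a 0 d"
      by (metis ut2_even_cases)
    have "nprod (replicate (Suc n) (ut2_mat a 0 d)) = ut2_mat (a ^ Suc n) 0 (d ^ Suc n)" for n
      by (induction n) (auto simp: ut2_mat_mult)
    from this[of "CARD('f) - 1"] have "nprod (replicate CARD('f) (ut2_mat a 0 d)) = ut2_mat a 0 d"
      by (simp add: power_CARD del: replicate_Suc power_Suc)
    moreover have "substitute ut2_scale \<sigma> (nprod (replicate CARD('f) (y_var 0))) =
        nprod (replicate CARD('f) (\<sigma> (Y 0)))"
      using ut2.substitute_word[of "replicate CARD('f) (Y 0)" \<sigma>] by simp
    ultimately show "substitute ut2_scale \<sigma> (nprod (replicate CARD('f) (y_var 0)) - y_var 0) = 0"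
      by (simp add: ut2.substitute_diff \<sigma>)
  qed
qed

lemma rel_free_class_eq_iff: "rel_free_class f = rel_free_class g \<longleftrightarrow> f - g \<in> Id_gr_ut2"
  by (rule rel_free.abs_eq_iff)

lemma linear_rel_free_class: "Vector_Spaces.linear free_scale rel_free_scale rel_free_class"
  by unfold_locales (simp_all add: plus_rel_free.abs_eq rel_free_scale.abs_eq)

text \<open>Independence of a set of classes cannot detect coinciding classes. Two keys with equal
  class would give a relation with coefficients 1 and -1.\<close>

lemma key_poly_class_inj:
  "inj_on (\<lambda>k. rel_free_class (key_poly k :: 'f::{field,finite} free_algebra)) (basis_keys CARD('f))"
proof (rule inj_onI, rule ccontr)
  fix k l
  assume kl: "k \<in> basis_keys CARD('f)" "l \<in> basis_keys CARD('f)" "k \<noteq> l"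
    and "rel_free_class (key_poly k :: 'f free_algebra) = rel_free_class (key_poly l)"
  then have diff: "key_poly k - key_poly l \<in> (Id_gr_ut2 :: 'f free_algebra set)"
    by (simp only: rel_free_class_eq_iff)
  define u :: "key \<Rightarrow> 'f" where "u m = (if m = k then 1 else - 1)" for m
  have "(\<Sum>m\<in>{k, l}. free_scale (u m) (key_poly m)) = key_poly k - key_poly l"
    using kl(3) by (simp add: u_def)
  then have "u k = 0"
    using key_polys_independent[of "{k, l}" u k] kl diff by simp
  then show False by (simp add: u_def)
qed

lemma key_poly_class_independent:
  "\<not> rel_free.dependent ((\<lambda>k. rel_free_class (key_poly k :: 'f::{field,finite} free_algebra)) ` basis_keys CARD('f))"
proof
  let ?h = "\<lambda>k. rel_free_class (key_poly k :: 'f free_algebra)"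
  interpret cls: Vector_Spaces.linear free_scale rel_free_scale "rel_free_class :: 'f free_algebra \<Rightarrow> _"
    by (rule linear_rel_free_class)
  assume "rel_free.dependent (?h ` basis_keys CARD('f))"
  then obtain T u v where T: "finite T" "T \<subseteq> ?h ` basis_keys CARD('f)"
    and sum: "(\<Sum>v\<in>T. rel_free_scale (u v) v) = 0" and v: "v \<in> T" "u v \<noteq> 0"
    unfolding rel_free.dependent_explicit by blast
  \<comment> \<open>Choosing finitely many keys over \<open>T\<close>, with injectivity on them,
    turns the relation between classes into one indexed by keys.\<close>
  from finite_subset_image[OF T] obtain K where K: "K \<subseteq> basis_keys CARD('f)" "finite K" "T = ?h ` K"
    by blast
  have "inj_on ?h K" using key_poly_class_inj K(1) by (rule inj_on_subset)
  then have "rel_free_class (\<Sum>k\<in>K. free_scale (u (?h k)) (key_poly k)) = rel_free_class 0"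
    using sum by (simp add: K(3) sum.reindex cls.sum cls.scale flip: zero_rel_free.abs_eq)
  then have "(\<Sum>k\<in>K. free_scale (u (?h k)) (key_poly k)) \<in> Id_gr_ut2"
    by (simp only: rel_free_class_eq_iff diff_0_right)
  then have "u (?h k) = 0" if "k \<in> K" for k
    using key_polys_independent[OF K(2,1), of "\<lambda>k. u (?h k)"] that by blast
  then show False using v K(3) by blast
qed

theorem theorem1:
  shows "(Id_gr_ut2 :: 'f::{field,finite} free_algebra set) =
           T2_ideal hull {z_var 0 * z_var 1, commutator (y_var 0) (y_var 1),
                          nprod (replicate CARD('f) (y_var 0)) - y_var 0} \<and>
         inj_on rel_free_class (basis_polys CARD('f) :: 'f free_algebra set) \<and>
         \<not> rel_free.dependent (rel_free_class ` (basis_polys CARD('f) :: 'f free_algebra set)) \<and>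
         rel_free.span (rel_free_class ` (basis_polys CARD('f) :: 'f free_algebra set)) = UNIV"
proof -
  let ?S = "{z_var 0 * z_var 1, commutator (y_var 0) (y_var 1),
    nprod (replicate CARD('f) (y_var 0)) - y_var 0 :: 'f free_algebra}"
  let ?J = "T2_ideal hull ?S" and ?B = "basis_polys CARD('f) :: 'f free_algebra set"
  interpret Id: ut2_relations "Id_gr_ut2 :: 'f free_algebra set"
    by (rule ut2_relations_superidentities)
  have "?S \<subseteq> ?J" by (rule hull_subset)
  then interpret J: ut2_relations ?J
    by unfold_locales (auto intro: T2_ideal_hull)
  interpret cls: Vector_Spaces.linear free_scale rel_free_scale "rel_free_class :: 'f free_algebra \<Rightarrow> _"
    by (rule linear_rel_free_class)

  have B: "?B \<subseteq> key_poly ` basis_keys CARD('f)" by (rule basis_polys_keys) simp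
  have inj: "inj_on rel_free_class ?B"
    using key_poly_class_inj by (intro inj_on_subset[OF _ B] inj_on_imageI) (simp add: comp_def)
  have indep: "\<not> rel_free.dependent (rel_free_class ` ?B)"
  proof
    assume "rel_free.dependent (rel_free_class ` ?B)"
    then have "rel_free.dependent (rel_free_class ` (key_poly :: _ \<Rightarrow> 'f free_algebra) ` basis_keys CARD('f))"
      by (rule rel_free.dependent_mono) (rule image_mono[OF B])
    then show False using key_poly_class_independent[where ?'f = 'f] by (simp add: image_image)
  qed
  have span: "rel_free.span (rel_free_class ` ?B) = UNIV"
  proof -
    have "c \<in> rel_free.span (rel_free_class ` ?B)" for c
    proof (induction c rule: rel_free.abs_induct)
      case (1 f)
      obtain g where g: "g \<in> free.span ?B" "f - g \<in> Id_gr_ut2"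
        using Id.reducible_all[of f] unfolding Id.reducible_def by blast
      have "rel_free_class g \<in> rel_free.span (rel_free_class ` ?B)"
        using g(1) by (simp add: cls.span_image)
      then show ?case using g(2) by (simp add: rel_free_class_eq_iff[THEN iffD2])
    qed
    then show ?thesis by blast
  qed
  have J_Id: "?J \<subseteq> Id_gr_ut2"
    using Id.zz Id.yy Id.yq Id.T2 by (intro hull_minimal) auto
  moreover have "Id_gr_ut2 \<subseteq> ?J"
  proof
    \<comment> \<open>The remainder \<open>g\<close> of \<open>f\<close> modulo \<open>?J\<close> is
      itself a superidentity, since \<open>?J\<close> consists of superidentities; so its class is
      0.\<close>
    fix f :: "'f free_algebra" assume f: "f \<in> Id_gr_ut2"
    obtain g where g: "g \<in> free.span ?B" "f - g \<in> ?J"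
      using J.reducible_all[of f] unfolding J.reducible_def by blast
    have "f - g \<in> Id_gr_ut2" using g(2) J_Id by blast
    from free.subspace_diff[OF Id.I_subspace f this] have "g \<in> Id_gr_ut2" by simp
    then have "rel_free_class g = 0"
      unfolding zero_rel_free.abs_eq rel_free_class_eq_iff by simp
    \<comment> \<open>Independence of the classes, without coincidences, makes the quotient map
      injective on all combinations, which forces \<open>g = 0\<close>.\<close>
    moreover have "inj_on rel_free_class (free.span ?B)"
      using inj indep by (rule cls.inj_on_span_independent_image[rotated])
    ultimately have "g = 0"
      using g(1) cls.zero free.span_zero by (metis inj_onD)
    then show "f \<in> ?J" using g(2) by simp
  qed
  ultimately have "Id_gr_ut2 = ?J" by blast
  with inj indep span show ?thesis by blast
qed

end
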